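(* Let $n \ge 1$ be an integer, let $0 < \alpha < n$, and let $I_{\alpha}$ be the discrete Riesz potential on $\mathbb{Z}^n$. Let $0 < p \leq 1$ and let $q$ be defined by $\frac{1}{q} = \frac{1}{p} - \frac{\alpha}{n}$. Then there exists a positive constant $C$, not depending on $b$, such that for every $b \in H^p(\mathbb{Z}^n)$ \[ \| I_{\alpha} b \|_{\ell^{q}(\mathbb{Z}^n)} \leq C \, \| b \|_{H^{p}(\mathbb{Z}^n)} . \]
   Context: Sequences are complex-valued functions $b = \{b(i)\}_{i \in \mathbb{Z}^n}$, and $|\cdot|$ is the Euclidean norm on $\mathbb{Z}^n$. For $0 < p < \infty$, $\ell^p(\mathbb{Z}^n)$ is the set of sequences with $\|b\|_{\ell^p(\mathbb{Z}^n)} := \left(\sum_{i \in \mathbb{Z}^n} |b(i)|^p\right)^{1/p} < \infty$ (only a quasi-norm when $p<1$). Discrete Riesz potential: for $0<\alpha<n$, \[ (I_{\alpha} b)(j) = \sum_{i \in \mathbb{Z}^n \setminus \{j\}} \frac{b(i)}{|i-j|^{n-\alpha}}, \qquad j \in \mathbb{Z}^n . \] Discrete Poisson kernel on $\mathbb{Z}^n$: for $t>0$, \[ P_t^d(j) = C_n \frac{t}{(t^2+|j|^2)^{(n+1)/2}} \ \text{ for } j \in \mathbb{Z}^n \setminus \{\mathbf{0}\}, \qquad P_t^d(\mathbf{0}) = 0, \] where $C_n>0$ is a normalizing constant depending only on the dimension $n$. Convolution on $\mathbb{Z}^n$ is $(P_t^d \ast_{\mathbb{Z}^n} b)(j) =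 \sum_{i \in \mathbb{Z}^n} P_t^d(j-i)\, b(i)$. Discrete Hardy space: for $0 < p \leq 1$, \[ H^p(\mathbb{Z}^n) = \left\{ b \in \ell^p(\mathbb{Z}^n) : \sup_{t>0} |P_t^d \ast_{\mathbb{Z}^n} b| \in \ell^p(\mathbb{Z}^n) \right\}, \] where the supremum is taken pointwise, with \[ \|b\|_{H^p(\mathbb{Z}^n)} := \|b\|_{\ell^p(\mathbb{Z}^n)} + \left\| \sup_{t>0} |P_t^d \ast_{\mathbb{Z}^n} b| \right\|_{\ell^p(\mathbb{Z}^n)} . \] *)

theory Defs
  imports "HOL-Analysis.Analysis"
begin

text \<open>
  The lattice of dimension \<open>n\<close> is the type \<^typ>\<open>int ^ 'n\<close>, with \<open>n = CARD('n) \<ge> 1\<close>.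
\<close>

definition znorm :: "int ^ 'n \<Rightarrow> real" where
  "znorm j = norm (\<chi> k. real_of_int (j $ k))"

definition ellp :: "real \<Rightarrow> (int ^ 'n \<Rightarrow> 'a::real_normed_vector) set" where
  "ellp p = {b. (\<lambda>i. norm (b i) powr p) summable_on UNIV}"

text \<open>Meaningful only on \<^term>\<open>ellp p\<close>: elsewhere \<^const>\<open>infsum\<close> defaults to \<open>0\<close>.\<close>

definition ellp_norm :: "real \<Rightarrow> (int ^ 'n \<Rightarrow> 'a::real_normed_vector) \<Rightarrow> real" where
  "ellp_norm p b = (\<Sum>\<^sub>\<infinity>i\<in>UNIV. norm (b i) powr p) powr (1 / p)"

text \<open>
  The series below converge absolutely for \<open>b\<close> in \<open>ellp p\<close> with \<open>0 < p \<le> 1\<close>: such \<open>b\<close> is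
  absolutely summable, and both kernels are bounded, since distinct lattice points have
  distance at least 1.
\<close>

definition riesz_potential :: "real \<Rightarrow> (int ^ 'n \<Rightarrow> complex) \<Rightarrow> int ^ 'n \<Rightarrow> complex" where
  "riesz_potential \<alpha> b j =
     (\<Sum>\<^sub>\<infinity>i\<in>UNIV - {j}. b i / of_real (znorm (i - j) powr (real CARD('n) - \<alpha>)))"

text \<open>
  The normalizing constant of the Poisson kernel is kept as a parameter \<open>c\<close>.
\<close>

definition poisson_kernel :: "real \<Rightarrow> real \<Rightarrow> int ^ 'n \<Rightarrow> real" where
  "poisson_kernel c t j =
     (if j = 0 then 0
      else c * (t / (t\<^sup>2 + (znorm j)\<^sup>2) powr ((real CARD('n) + 1) / 2)))"

definition zconv :: "(int ^ 'n \<Rightarrow> real) \<Rightarrow> (int ^ 'n \<Rightarrow> complex) \<Rightarrow> int ^ 'n \<Rightarrow> complex" where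
  "zconv K b j = (\<Sum>\<^sub>\<infinity>i\<in>UNIV. of_real (K (j - i)) * b i)"

definition poisson_maximal :: "real \<Rightarrow> (int ^ 'n \<Rightarrow> complex) \<Rightarrow> int ^ 'n \<Rightarrow> real" where
  "poisson_maximal c b j = (SUP t\<in>{0<..}. norm (zconv (poisson_kernel c t) b j))"

text \<open>
  The boundedness clause says that the pointwise supremum is finite (on unbounded sets the real
  supremum is unspecified).  It is automatic for \<open>b\<close> in \<open>ellp p\<close> with \<open>0 < p \<le> 1\<close>.
\<close>

definition hardy_space :: "real \<Rightarrow> real \<Rightarrow> (int ^ 'n \<Rightarrow> complex) set" where
  "hardy_space c p =
     {b \<in> ellp p.
        (\<forall>j. bdd_above ((\<lambda>t. norm (zconv (poisson_kernel c t) b j)) ` {0<..})) \<and>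
        poisson_maximal c b \<in> ellp p}"

definition hardy_norm :: "real \<Rightarrow> real \<Rightarrow> (int ^ 'n \<Rightarrow> complex) \<Rightarrow> real" where
  "hardy_norm c p b = ellp_norm p b + ellp_norm p (poisson_maximal c b)"

end

theory Submission imports Defs begin

text \<open>
  Since \<open>\<integral>\<^sub>0\<^sup>\<infinity> t\<^bsup>\<alpha>-1\<^esup> P\<^sub>t(j) dt\<close> is a multiple of \<open>|j|\<^bsup>\<alpha>-n\<^esup>\<close> for \<open>j \<noteq> 0\<close>, and both kernels omit the
  origin, \<open>I\<^sub>\<alpha> b(j)\<close> is a multiple of \<open>\<integral>\<^sub>0\<^sup>\<infinity> t\<^bsup>\<alpha>-1\<^esup> (P\<^sub>t * b)(j) dt\<close>.  As in Hedberg's inequality the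
  integral is split at some \<open>T \<ge> 1\<close>.  Below \<open>T\<close> the integrand is controlled by the maximal function
  \<open>M(j)\<close>.  Above \<open>T\<close> one uses \<open>|(P\<^sub>t * b)(j)| \<le> C (t\<^bsup>-n/p\<^esup> N + t\<^bsup>-n\<^esup> |b(j)|)\<close> with \<open>N\<close> the Hardy norm of
  \<open>b\<close>.  Optimizing \<open>T\<close> gives \<open>|I\<^sub>\<alpha> b(j)| \<le> C (M(j)\<^bsup>p/q\<^esup> N\<^bsup>1-p/q\<^esup> + |b(j)|)\<close>, whose \<open>q\<close>-th power is summable.

  For the decay, let \<open>u(x, t)\<close> be the Poisson extension of \<open>b\<close> to the upper half-space, the origin term
  of the kernel included.  It is harmonic, so it varies on the scale \<open>\<epsilon> t\<close> by at most
  \<open>C \<epsilon> sup {|u(y, s)|. s \<ge> t/2}\<close>.  Among the roughly \<open>(\<epsilon> t)\<^sup>n\<close> lattice points within \<open>\<epsilon> t\<close> of \<open>x\<close> there is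
  one at which \<open>|u|\<close> is at most \<open>(\<epsilon> t)\<^bsup>-n/p\<^esup>\<close> times the \<open>p\<close>-norm of the maximal function.  Adding the two
  bounds and iterating over dyadic \<open>t\<close>, with \<open>\<epsilon>\<close> small, gives \<open>|u(x, t)| \<le> C t\<^bsup>-n/p\<^esup> N\<close> for \<open>t \<ge> 1\<close>.
\<close>

subsection \<open>Harmonic functions and a difference estimate\<close>

text \<open>If \<open>l\<close> were positive, \<open>g'\<close> would vanish at 0 and be positive
  just to the right, so by the mean value theorem \<open>g\<close> would exceed \<open>g 0\<close>
  there.\<close>

lemma second_derivative_local_max:
  fixes g g' :: "real \<Rightarrow> real"
  assumes r: "r > 0" and g: "\<And>s. \<bar>s\<bar> < r \<Longrightarrow> (g has_real_derivative g' s) (at s)"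
    and g': "(g' has_real_derivative l) (at 0)"
    and max: "\<And>s. \<bar>s\<bar> < r \<Longrightarrow> g s \<le> g 0"
  shows "l \<le> 0"
proof (rule ccontr)
  assume "\<not> l \<le> 0"
  then have "l > 0" by simp
  have 0: "g' 0 = 0"
    by (rule DERIV_local_max[OF g[of 0] r]) (use r max in auto)
  obtain d where d: "d > 0" "\<And>h. 0 < h \<Longrightarrow> h < d \<Longrightarrow> g' 0 < g' (0 + h)"
    using DERIV_pos_inc_right[OF g' \<open>l > 0\<close>] by blast
  define h where "h = min d r / 2"
  have h: "0 < h" "h < d" "h < r" using d(1) r by (auto simp: h_def)
  obtain z where z: "0 < z" "z < h" "g h - g 0 = (h - 0) * g' z"
    using MVT2[of 0 h g g'] h g by fastforce
  have "g' z > 0" using d(2)[of z] z h 0 by simp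
  then have "g h > g 0" using z h by (smt (verit) mult_pos_pos)
  then show False using max[of h] h by simp
qed

section \<open>Pure second derivatives and the coordinate Laplacian\<close>

text \<open>The first derivative is required on a whole segment, the second only at its centre. A
  maximum principle tests a function along just such segments.\<close>

definition has_second_derivative_along ::
    "('a::real_normed_vector \<Rightarrow> real) \<Rightarrow> 'a \<Rightarrow> 'a \<Rightarrow> real \<Rightarrow> bool" where
  "has_second_derivative_along f b X l \<longleftrightarrow>
     (\<exists>g' r. r > 0 \<and> (\<forall>s. \<bar>s\<bar> < r \<longrightarrow> ((\<lambda>s. f (X + s *\<^sub>R b)) has_real_derivative g' s) (at s)) \<and>
        (g' has_real_derivative l) (at 0))"

lemma has_second_derivative_along_add:
  assumes "has_second_derivative_along f b X l" "has_second_derivative_along g b X m"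
  shows "has_second_derivative_along (\<lambda>X. f X + g X) b X (l + m)"
proof -
  obtain f' r where f: "r > 0" "\<And>s. \<bar>s\<bar> < r \<Longrightarrow> ((\<lambda>s. f (X + s *\<^sub>R b)) has_real_derivative f' s) (at s)"
    "(f' has_real_derivative l) (at 0)"
    using assms(1) unfolding has_second_derivative_along_def by blast
  obtain g' r' where g: "r' > 0" "\<And>s. \<bar>s\<bar> < r' \<Longrightarrow> ((\<lambda>s. g (X + s *\<^sub>R b)) has_real_derivative g' s) (at s)"
    "(g' has_real_derivative m) (at 0)"
    using assms(2) unfolding has_second_derivative_along_def by blast
  show ?thesis unfolding has_second_derivative_along_def
    using f g by (intro exI[of _ "\<lambda>s. f' s + g' s"] exI[of _ "min r r'"]) (auto intro!: DERIV_add)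
qed

lemma has_second_derivative_along_cmult:
  assumes "has_second_derivative_along f b X l"
  shows "has_second_derivative_along (\<lambda>X. c * f X) b X (c * l)"
proof -
  obtain f' r where f: "r > 0" "\<And>s. \<bar>s\<bar> < r \<Longrightarrow> ((\<lambda>s. f (X + s *\<^sub>R b)) has_real_derivative f' s) (at s)"
    "(f' has_real_derivative l) (at 0)"
    using assms(1) unfolding has_second_derivative_along_def by blast
  show ?thesis unfolding has_second_derivative_along_def
    using f by (intro exI[of _ "\<lambda>s. c * f' s"] exI[of _ r]) (auto intro!: DERIV_cmult)
qed

text \<open>Reversing the line changes the sign of the first derivative, and the chain rule restores
  it in the second. This serves the reflection in \<open>has_laplacian_reflect\<close>.\<close>

lemma has_second_derivative_along_uminus_direction:
  assumes "has_second_derivative_along f b X l"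
  shows "has_second_derivative_along f (- b) X l"
proof -
  obtain f' r where f: "r > 0" "\<And>s. \<bar>s\<bar> < r \<Longrightarrow> ((\<lambda>s. f (X + s *\<^sub>R b)) has_real_derivative f' s) (at s)"
    "(f' has_real_derivative l) (at 0)"
    using assms(1) unfolding has_second_derivative_along_def by blast
  have 1: "((\<lambda>s. f (X + s *\<^sub>R (- b))) has_real_derivative - f' (- s)) (at s)" if "\<bar>s\<bar> < r" for s
    using DERIV_chain2[where f = "\<lambda>s. f (X + s *\<^sub>R b)" and g = "\<lambda>s. - s" and x = s and Db = "-1" and s = UNIV,
        OF f(2)[of "-s"] DERIV_minus[OF DERIV_ident]] that
    by simp
  have 2: "((\<lambda>s. - f' (- s)) has_real_derivative l) (at 0)"
    using DERIV_minus[OF DERIV_chain2[where f = f' and g = "\<lambda>s. - s" and x = 0 and s = UNIV,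
        OF _ DERIV_minus[OF DERIV_ident]]] f(3)
    by simp
  show ?thesis unfolding has_second_derivative_along_def
    using 1 2 f(1) by (intro exI[of _ "\<lambda>s. - f' (- s)"] exI[of _ r]) auto
qed

text \<open>A relation rather than a function, so that existence of the pure second derivatives is
  part of the claim. Harmonicity on a set is expressed as \<open>has_laplacian f X 0\<close> at each
  of its points.\<close>

definition has_laplacian :: "('a::euclidean_space \<Rightarrow> real) \<Rightarrow> 'a \<Rightarrow> real \<Rightarrow> bool" where
  "has_laplacian f X L \<longleftrightarrow>
     (\<exists>l. (\<forall>b\<in>Basis. has_second_derivative_along f b X (l b)) \<and> L = (\<Sum>b\<in>Basis. l b))"

lemma has_laplacian_add:
  assumes "has_laplacian f X L" "has_laplacian g X M"
  shows "has_laplacian (\<lambda>X. f X + g X) X (L + M)"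
proof -
  obtain l m where "\<And>b. b \<in> Basis \<Longrightarrow> has_second_derivative_along f b X (l b)" "L = (\<Sum>b\<in>Basis. l b)"
    "\<And>b. b \<in> Basis \<Longrightarrow> has_second_derivative_along g b X (m b)" "M = (\<Sum>b\<in>Basis. m b)"
    using assms unfolding has_laplacian_def by auto
  then show ?thesis unfolding has_laplacian_def
    by (intro exI[of _ "\<lambda>b. l b + m b"]) (simp add: has_second_derivative_along_add sum.distrib)
qed

lemma has_laplacian_cmult:
  assumes "has_laplacian f X L"
  shows "has_laplacian (\<lambda>X. c * f X) X (c * L)"
proof -
  obtain l where "\<And>b. b \<in> Basis \<Longrightarrow> has_second_derivative_along f b X (l b)" "L = (\<Sum>b\<in>Basis. l b)"
    using assms unfolding has_laplacian_def by auto
  then show ?thesis unfolding has_laplacian_def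
    by (intro exI[of _ "\<lambda>b. c * l b"]) (simp add: has_second_derivative_along_cmult sum_distrib_left)
qed

lemma has_laplacian_zero: "has_laplacian (\<lambda>X. 0) X 0"
  unfolding has_laplacian_def has_second_derivative_along_def
  by (intro exI[of _ "\<lambda>b. 0"]) (auto intro!: exI[of _ "\<lambda>s. 0"] exI[of _ 1])

lemma has_laplacian_sum_zero:
  assumes "\<And>i. i \<in> F \<Longrightarrow> has_laplacian (f i) X 0"
  shows "has_laplacian (\<lambda>X. \<Sum>i\<in>F. f i X) X 0"
  using assms
proof (induction F rule: infinite_finite_induct)
  case (insert i F)
  then show ?case using has_laplacian_add[of "f i" X 0 "\<lambda>X. \<Sum>i\<in>F. f i X" 0] by simp
qed (auto intro: has_laplacian_zero)

lemma has_laplacian_translate: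
  assumes "has_laplacian f (a + X) L"
  shows "has_laplacian (\<lambda>X. f (a + X)) X L"
  using assms unfolding has_laplacian_def has_second_derivative_along_def by (simp add: add.assoc)

text \<open>The reflection fixes every other coordinate direction and reverses \<open>e\<close>, and
  a pure second derivative does not see the sign of its direction.\<close>

lemma has_laplacian_reflect:
  assumes e: "e \<in> Basis" and "has_laplacian f (X - (2 * (X \<bullet> e)) *\<^sub>R e) L"
  shows "has_laplacian (\<lambda>X. f (X - (2 * (X \<bullet> e)) *\<^sub>R e)) X L"
proof -
  let ?Y = "X - (2 * (X \<bullet> e)) *\<^sub>R e"
  obtain l where l: "\<And>b. b \<in> Basis \<Longrightarrow> has_second_derivative_along f b ?Y (l b)" "L = (\<Sum>b\<in>Basis. l b)"
    using assms unfolding has_laplacian_def by auto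
  have "has_second_derivative_along (\<lambda>X. f (X - (2 * (X \<bullet> e)) *\<^sub>R e)) b X (l b)" if b: "b \<in> Basis" for b
  proof (cases "b = e")
    case True
    have "(X + s *\<^sub>R b) - (2 * ((X + s *\<^sub>R b) \<bullet> e)) *\<^sub>R e = ?Y + s *\<^sub>R (- b)" for s
      using e True by (simp add: inner_add_left inner_diff_left algebra_simps scaleR_2 flip: scaleR_add_left)
    then have "X + s *\<^sub>R b - (2 * ((X + s *\<^sub>R b) \<bullet> e)) *\<^sub>R e = X - (2 * (X \<bullet> e)) *\<^sub>R e - s *\<^sub>R b" for s
      by simp
    then show ?thesis
      using has_second_derivative_along_uminus_direction[OF l(1)[OF b]]
      unfolding has_second_derivative_along_def by (simp only: scaleR_minus_right add_uminus_conv_diff)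
  next
    case False
    have "(X + s *\<^sub>R b) - (2 * ((X + s *\<^sub>R b) \<bullet> e)) *\<^sub>R e = ?Y + s *\<^sub>R b" for s
      using e b False by (simp add: algebra_simps inner_Basis)
    then show ?thesis
      using l(1)[OF b] unfolding has_second_derivative_along_def by (simp only:)
  qed
  then show ?thesis using l(2) unfolding has_laplacian_def by blast
qed

text \<open>Otherwise every pure second derivative would be nonpositive, and so would their sum. A
  witness on a coordinate line is easily kept inside a cube.\<close>

lemma positive_laplacian_not_local_max:
  assumes "has_laplacian f X L" "L > 0" "r > 0"
  shows "\<exists>b\<in>Basis. \<exists>s. \<bar>s\<bar> < r \<and> f (X + s *\<^sub>R b) > f X"
proof (rule ccontr)
  assume con: "\<not> ?thesis"
  obtain l where l: "\<And>b. b \<in> Basis \<Longrightarrow> has_second_derivative_along f b X (l b)" "L = (\<Sum>b\<in>Basis. l b)"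
    using assms unfolding has_laplacian_def by auto
  have "l b \<le> 0" if b: "b \<in> Basis" for b
  proof -
    obtain f' r' where f: "r' > 0" "\<And>s. \<bar>s\<bar> < r' \<Longrightarrow> ((\<lambda>s. f (X + s *\<^sub>R b)) has_real_derivative f' s) (at s)"
      "(f' has_real_derivative l b) (at 0)"
      using l(1)[OF b] unfolding has_second_derivative_along_def by blast
    have "f (X + s *\<^sub>R b) \<le> f X" if "\<bar>s\<bar> < r" for s
      using con b that by (meson not_less)
    then show ?thesis
      by (intro second_derivative_local_max[of "min r r'" "\<lambda>s. f (X + s *\<^sub>R b)" f'])
         (use f assms(3) in auto)
  qed
  then have "L \<le> 0" using l(2) by (simp add: sum_nonpos)
  then show False using assms(2) by simp
qed

section \<open>A boundary estimate on a half-cube by means of a barrier\<close>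

text \<open>
  The barrier of Gilbarg and Trudinger, Section 3.4: times \<open>M / d\<^sup>2\<close> it is strictly
  superharmonic, nonnegative on the half-cube \<open>0 \<le> X \<bullet> e\<close>, \<open>|X \<bullet> b| \<le> d\<close>, and at least \<open>M\<close> on all its
  faces except \<open>X \<bullet> e = 0\<close>.
\<close>

lemma half_cube_barrier_laplacian:
  fixes e :: "'a::euclidean_space"
  assumes "e \<in> Basis"
  shows "has_laplacian (\<lambda>X. X \<bullet> X + (real DIM('a) + 1) * (d * (X \<bullet> e) - (X \<bullet> e)\<^sup>2)) X (- 2)"
proof -
  let ?k = "real DIM('a) + 1"
  have "has_second_derivative_along (\<lambda>X. X \<bullet> X + ?k * (d * (X \<bullet> e) - (X \<bullet> e)\<^sup>2)) b X
      (2 - (if b = e then 2 * ?k else 0))" if b: "b \<in> Basis" for b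
  proof -
    have 1: "((\<lambda>s. (X + s *\<^sub>R b) \<bullet> (X + s *\<^sub>R b) + ?k * (d * ((X + s *\<^sub>R b) \<bullet> e) - ((X + s *\<^sub>R b) \<bullet> e)\<^sup>2))
        has_real_derivative (2 * (X \<bullet> b) + 2 * s + ?k * (d * (b \<bullet> e) - 2 * (X \<bullet> e + s * (b \<bullet> e)) * (b \<bullet> e)))) (at s)" for s
      using b by (auto intro!: derivative_eq_intros simp: inner_add_left inner_add_right inner_commute algebra_simps)
    have 2: "((\<lambda>s. 2 * (X \<bullet> b) + 2 * s + ?k * (d * (b \<bullet> e) - 2 * (X \<bullet> e + s * (b \<bullet> e)) * (b \<bullet> e)))
       has_real_derivative (2 - (if b = e then 2 * ?k else 0))) (at 0)"
      using b assms by (auto intro!: derivative_eq_intros simp: inner_Basis)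
    show ?thesis unfolding has_second_derivative_along_def
      by (rule exI, rule exI[of _ 1], intro conjI allI impI, simp, rule 1, rule 2)
  qed
  moreover have "(- 2) = (\<Sum>b\<in>Basis. 2 - (if b = e then 2 * ?k else 0))"
    using assms by (simp add: sum_subtractf)
  ultimately show ?thesis unfolding has_laplacian_def
    by (intro exI[of _ "\<lambda>b. 2 - (if b = e then 2 * ?k else 0)"]) blast
qed

text \<open>Subtracting \<open>M / d^2\<close> times the barrier makes \<open>v\<close> strictly
  subharmonic, so the maximum over the half-cube lies on its boundary, where the difference is at
  most 0. On the axis the barrier grows at most linearly in \<open>z\<close>.\<close>

lemma half_cube_bound:
  fixes e :: "'a::euclidean_space"
  assumes e: "e \<in> Basis" and d: "d > 0" and M: "M > 0"
    and cont: "continuous_on (cbox (- d *\<^sub>R One) (d *\<^sub>R One)) v"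
    and vM: "\<And>X. X \<in> cbox (- d *\<^sub>R One) (d *\<^sub>R One) \<Longrightarrow> v X \<le> M"
    and v0: "\<And>X. X \<in> cbox (- d *\<^sub>R One) (d *\<^sub>R One) \<Longrightarrow> X \<bullet> e = 0 \<Longrightarrow> v X \<le> 0"
    and lap: "\<And>X. X \<in> cbox (- d *\<^sub>R One) (d *\<^sub>R One) \<Longrightarrow> has_laplacian v X 0"
    and z: "0 \<le> z" "z \<le> d"
  shows "v (z *\<^sub>R e) \<le> M * (real DIM('a) + 1) * z / d"
proof -
  let ?k = "real DIM('a) + 1"
  define \<psi> where "\<psi> = (\<lambda>X. X \<bullet> X + ?k * (d * (X \<bullet> e) - (X \<bullet> e)\<^sup>2))"
  define Q where "Q = cbox (- d *\<^sub>R One) (d *\<^sub>R One) \<inter> {X. e \<bullet> X \<ge> 0}"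
  define h where "h = (\<lambda>X. v X + (- M / d\<^sup>2) * \<psi> X)"
  have Q: "X \<in> Q \<longleftrightarrow> (\<forall>b\<in>Basis. \<bar>X \<bullet> b\<bar> \<le> d) \<and> 0 \<le> X \<bullet> e" for X
    by (auto simp: Q_def mem_box inner_commute[of e] abs_le_iff)
  have "compact Q" unfolding Q_def by (intro compact_Int_closed compact_cbox closed_halfspace_ge)
  have zQ: "z *\<^sub>R e \<in> Q" using z e d by (auto simp: Q inner_Basis)
  have conth: "continuous_on Q h" unfolding h_def \<psi>_def
    by (intro continuous_intros continuous_on_subset[OF cont]) (auto simp: Q_def)
  obtain X where X: "X \<in> Q" "\<And>Y. Y \<in> Q \<Longrightarrow> h Y \<le> h X"
    using continuous_attains_sup[OF \<open>compact Q\<close> _ conth] zQ by blast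
  have Xc: "X \<in> cbox (- d *\<^sub>R One) (d *\<^sub>R One)" using X(1) by (simp add: Q_def)
  have hk: "0 \<le> d * (X \<bullet> e) - (X \<bullet> e)\<^sup>2"
    using X(1) e by (auto simp: Q power2_eq_square abs_le_iff simp flip: left_diff_distrib)
  have hX: "h X \<le> 0"
  proof (cases "X \<bullet> e = 0")
    case True
    have "\<psi> X \<ge> 0" using True by (simp add: \<psi>_def)
    then show ?thesis using v0[OF Xc True] M d by (simp add: h_def) (smt (verit) divide_nonneg_nonneg mult_nonneg_nonneg zero_le_power2)
  next
    case nz: False
    show ?thesis
    proof (cases "\<exists>b\<in>Basis. \<bar>X \<bullet> b\<bar> = d")
      case True
      then obtain b where b: "b \<in> Basis" "\<bar>X \<bullet> b\<bar> = d" by blast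
      have "d\<^sup>2 = (X \<bullet> b)\<^sup>2" using b by (metis power2_abs)
      also have "\<dots> \<le> X \<bullet> X" using Basis_le_norm[OF b(1), of X]
        by (metis abs_le_square_iff abs_norm_cancel power2_norm_eq_inner)
      finally have "\<psi> X \<ge> d\<^sup>2" using hk by (simp add: \<psi>_def) (smt (verit) mult_nonneg_nonneg of_nat_0_le_iff)
      then have "M / d\<^sup>2 * \<psi> X \<ge> M / d\<^sup>2 * d\<^sup>2" using M by (intro mult_left_mono) auto
      then show ?thesis using vM[OF Xc] d by (simp add: h_def)
    next
      case False
      have lt: "\<bar>X \<bullet> b\<bar> < d" if "b \<in> Basis" for b using False that X(1) by (force simp: Q)
      \<comment> \<open>A move by less than \<open>r\<close> along one coordinate direction stays in
        \<open>Q\<close>: the first entry protects the flat face, the second all other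
        faces.\<close>
      define r where "r = min (X \<bullet> e) (Min ((\<lambda>b. d - \<bar>X \<bullet> b\<bar>) ` Basis))"
      have r: "r > 0" using lt nz X(1) by (auto simp: r_def Q)
      have rb: "r \<le> d - \<bar>X \<bullet> b\<bar>" if "b \<in> Basis" for b
        unfolding r_def by (rule min.coboundedI2) (use that in auto)
      have "has_laplacian h X (0 + (- M / d\<^sup>2) * (-2))" unfolding h_def \<psi>_def
        by (intro has_laplacian_add lap Xc has_laplacian_cmult half_cube_barrier_laplacian e)
      moreover have "0 + (- M / d\<^sup>2) * (-2) > 0" using M d by simp
      ultimately obtain b s where bs: "b \<in> Basis" "\<bar>s\<bar> < r" "h (X + s *\<^sub>R b) > h X"
        using positive_laplacian_not_local_max[OF _ _ r] by blast
      have "X + s *\<^sub>R b \<in> Q" unfolding Q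
      proof (intro conjI ballI)
        fix b' assume b': "b' \<in> (Basis :: 'a set)"
        have "\<bar>(X + s *\<^sub>R b) \<bullet> b'\<bar> \<le> \<bar>X \<bullet> b'\<bar> + \<bar>s\<bar>"
          using bs(1) b' by (auto simp: inner_add_left inner_Basis)
        then show "\<bar>(X + s *\<^sub>R b) \<bullet> b'\<bar> \<le> d" using rb[OF b'] bs(2) by linarith
      next
        have "r \<le> X \<bullet> e" by (simp add: r_def)
        then show "0 \<le> (X + s *\<^sub>R b) \<bullet> e"
          using bs e by (auto simp: inner_add_left inner_Basis)
      qed
      then show ?thesis using X(2) bs(3) by fastforce
    qed
  qed
  have "h (z *\<^sub>R e) \<le> 0" using X(2)[OF zQ] hX by simp
  then have "v (z *\<^sub>R e) \<le> M / d\<^sup>2 * \<psi> (z *\<^sub>R e)" by (simp add: h_def)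
  \<comment> \<open>On the axis the barrier is \<open>z^2 + ?k * (d * z - z^2)\<close>, which is at
    most \<open>?k * d * z\<close> because \<open>?k \<ge> 1\<close>.\<close>
  also have "M / d\<^sup>2 * \<psi> (z *\<^sub>R e) \<le> M / d\<^sup>2 * (?k * (d * z))"
    using M d e by (intro mult_left_mono) (auto simp: \<psi>_def power2_eq_square algebra_simps z)
  also have "\<dots> = M * ?k * z / d" using d by (simp add: power2_eq_square field_simps)
  finally show ?thesis .
qed

text \<open>The odd part of \<open>u\<close> in the direction \<open>e\<close> vanishes on the hyperplane \<open>X \<bullet> e = X0 \<bullet> e\<close>.\<close>

lemma harmonic_central_difference_le:
  fixes e :: "'a::euclidean_space"
  assumes e: "e \<in> Basis" and d: "d > 0" and M: "M > 0"
    and cont: "continuous_on {X. \<forall>b\<in>Basis. \<bar>(X - X0) \<bullet> b\<bar> \<le> d} u"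
    and uM: "\<And>X. (\<And>b. b \<in> Basis \<Longrightarrow> \<bar>(X - X0) \<bullet> b\<bar> \<le> d) \<Longrightarrow> \<bar>u X\<bar> \<le> M"
    and lap: "\<And>X. (\<And>b. b \<in> Basis \<Longrightarrow> \<bar>(X - X0) \<bullet> b\<bar> \<le> d) \<Longrightarrow> has_laplacian u X 0"
    and z: "0 \<le> z" "z \<le> d"
  shows "u (X0 + z *\<^sub>R e) - u (X0 - z *\<^sub>R e) \<le> 2 * M * (real DIM('a) + 1) * z / d"
proof -
  define R where "R = (\<lambda>X. X - (2 * (X \<bullet> e)) *\<^sub>R e)"
  \<comment> \<open>The halves keep the bound \<open>M\<close> for \<open>v\<close> and account for
    the factor 2 in the conclusion.\<close>
  define v where "v = (\<lambda>X. (1/2) * u (X0 + X) + (-1/2) * u (X0 + R X))"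
  let ?B = "cbox (- d *\<^sub>R One) (d *\<^sub>R One) :: 'a set"
  have B: "X \<in> ?B \<longleftrightarrow> (\<forall>b\<in>Basis. \<bar>X \<bullet> b\<bar> \<le> d)" for X
    by (auto simp: mem_box abs_le_iff)
  have RB: "R X \<in> ?B" if "X \<in> ?B" for X
    using that e unfolding B R_def by (auto simp: inner_diff_left inner_Basis)
  have "v (z *\<^sub>R e) \<le> M * (real DIM('a) + 1) * z / d"
  proof (rule half_cube_bound[OF e d M _ _ _ _ z])
    show "continuous_on ?B v" unfolding v_def
    proof (intro continuous_on_add continuous_on_mult continuous_on_const)
      show "continuous_on ?B (\<lambda>X. u (X0 + X))"
      proof (rule continuous_on_compose2[OF cont])
        show "(\<lambda>X. X0 + X) ` ?B \<subseteq> {X. \<forall>b\<in>Basis. \<bar>(X - X0) \<bullet> b\<bar> \<le> d}"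
          unfolding image_subset_iff mem_Collect_eq add_diff_cancel_left' using B by blast
      qed (intro continuous_intros)
      show "continuous_on ?B (\<lambda>X. u (X0 + R X))"
      proof (rule continuous_on_compose2[OF cont])
        show "(\<lambda>X. X0 + R X) ` ?B \<subseteq> {X. \<forall>b\<in>Basis. \<bar>(X - X0) \<bullet> b\<bar> \<le> d}"
          unfolding image_subset_iff mem_Collect_eq add_diff_cancel_left' using B RB by blast
        show "continuous_on ?B (\<lambda>X. X0 + R X)"
          unfolding R_def by (intro continuous_intros)
      qed
    qed
  next
    fix X assume X: "X \<in> ?B"
    have XR: "\<bar>(X0 + X - X0) \<bullet> b\<bar> \<le> d" "\<bar>(X0 + R X - X0) \<bullet> b\<bar> \<le> d" if "b \<in> Basis" for b
      using X RB[OF X] that unfolding B by (simp_all only: add_diff_cancel_left')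
    have "\<bar>u (X0 + X)\<bar> \<le> M" "\<bar>u (X0 + R X)\<bar> \<le> M"
      by (rule uM, rule XR, assumption)+
    then show "v X \<le> M" by (simp add: v_def)
    show "v X \<le> 0" if "X \<bullet> e = 0" using that by (simp add: v_def R_def)
    have 1: "has_laplacian u (X0 + X) 0" "has_laplacian u (X0 + R X) 0"
      by (rule lap, rule XR, assumption)+
    have "has_laplacian (\<lambda>X. u (X0 + R X)) X 0"
      unfolding R_def by (rule has_laplacian_reflect[OF e], rule has_laplacian_translate)
        (use 1 in \<open>simp add: R_def\<close>)
    then have "has_laplacian v X ((1/2) * 0 + (-1/2) * 0)"
      unfolding v_def by (intro has_laplacian_add has_laplacian_cmult has_laplacian_translate 1)
    then show "has_laplacian v X 0" by simp
  qed
  moreover have "R (z *\<^sub>R e) = - (z *\<^sub>R e)" using e by (simp add: R_def scaleR_2 flip: scaleR_scaleR)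
  ultimately show ?thesis by (simp add: v_def)
qed

section \<open>Harmonicity of the half-space Poisson kernel\<close>

text \<open>Up to a constant factor, the Poisson kernel of the half-space with inner normal
  \<open>\<tau>\<close>. The dimension in the exponent is that of the ambient space, one more than
  that of the boundary.\<close>

definition halfspace_poisson :: "'a::euclidean_space \<Rightarrow> 'a \<Rightarrow> real" where
  "halfspace_poisson \<tau> Y = (Y \<bullet> \<tau>) * (Y \<bullet> Y) powr (- (real DIM('a) / 2))"

text \<open>With \<open>m\<close> half the dimension and \<open>\<rho> = Y \<bullet> Y\<close>, the
  three terms of \<open>l\<close> sum over the basis to \<open>a * \<rho> powr (-m - 1)\<close>
  times \<open>-4m\<close>, \<open>4m(m + 1)\<close> and \<open>-4m^2\<close>, which cancel.\<close>

lemma has_laplacian_halfspace_poisson: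
  fixes Y \<tau> :: "'a::euclidean_space"
  assumes \<tau>: "\<tau> \<in> Basis" and Y: "Y \<noteq> 0"
  shows "has_laplacian (halfspace_poisson \<tau>) Y 0"
proof -
  define m where "m = real DIM('a) / 2"
  define \<rho> where "\<rho> = Y \<bullet> Y"
  have \<rho>: "\<rho> > 0" using Y by (simp add: \<rho>_def)
  define a where "a = Y \<bullet> \<tau>"
  define l where "l b = - 4 * m * (Y \<bullet> b) * (b \<bullet> \<tau>) * \<rho> powr (-m - 1)
      + 4 * m * (m + 1) * a * (Y \<bullet> b)\<^sup>2 * \<rho> powr (-m - 2) - 2 * m * a * \<rho> powr (-m - 1)" for b
  have "has_second_derivative_along (halfspace_poisson \<tau>) b Y (l b)" if b: "b \<in> Basis" for b
  proof -
    define \<rho>' where "\<rho>' s = \<rho> + 2 * s * (Y \<bullet> b) + s\<^sup>2" for s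
    have \<rho>': "(Y + s *\<^sub>R b) \<bullet> (Y + s *\<^sub>R b) = \<rho>' s" for s
      using b by (simp add: \<rho>_def \<rho>'_def inner_add_left inner_add_right inner_commute power2_eq_square)
    have pos: "\<rho>' s > 0" if "\<bar>s\<bar> < norm Y" for s
    proof -
      have "norm (s *\<^sub>R b) < norm Y" using that b by simp
      then have "Y + s *\<^sub>R b \<noteq> 0" by (metis add_eq_0_iff norm_minus_cancel order_less_irrefl)
      then show ?thesis by (simp flip: \<rho>')
    qed
    define g' where "g' s = (b \<bullet> \<tau>) * \<rho>' s powr (-m)
        + (a + s * (b \<bullet> \<tau>)) * (- m * \<rho>' s powr (-m - 1) * (2 * (Y \<bullet> b) + 2 * s))" for s
    have d\<rho>: "(\<rho>' has_real_derivative (2 * (Y \<bullet> b) + 2 * s)) (at s)" for s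
      unfolding \<rho>'_def by (auto intro!: derivative_eq_intros)
    have dp: "((\<lambda>s. \<rho>' s powr k) has_real_derivative (k * \<rho>' s powr (k - 1) * (2 * (Y \<bullet> b) + 2 * s))) (at s)"
      if "\<bar>s\<bar> < norm Y" for s k
      using DERIV_fun_powr[OF d\<rho> pos[OF that], of k] by (simp add: mult_ac)
    have 1: "((\<lambda>s. halfspace_poisson \<tau> (Y + s *\<^sub>R b)) has_real_derivative g' s) (at s)"
      if s: "\<bar>s\<bar> < norm Y" for s
    proof -
      have "((\<lambda>s. (Y + s *\<^sub>R b) \<bullet> \<tau>) has_real_derivative (b \<bullet> \<tau>)) (at s)"
        by (auto intro!: derivative_eq_intros simp: inner_add_left)
      from DERIV_mult[OF this dp[OF s, of "-m"]] show ?thesis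
        unfolding halfspace_poisson_def \<rho>' m_def[symmetric] g'_def a_def
        by (simp add: inner_add_left algebra_simps)
    qed
    have 2: "(g' has_real_derivative l b) (at 0)"
    proof -
      have "(g' has_real_derivative
          (b \<bullet> \<tau>) * (- m * \<rho>' 0 powr (-m - 1) * (2 * (Y \<bullet> b) + 2 * 0))
          + ((b \<bullet> \<tau>) * (- m * \<rho>' 0 powr (-m - 1) * (2 * (Y \<bullet> b) + 2 * 0))
            + (- m * ((-m - 1) * \<rho>' 0 powr (-m - 1 - 1) * (2 * (Y \<bullet> b) + 2 * 0)) * (2 * (Y \<bullet> b) + 2 * 0)
               + 2 * (- m * \<rho>' 0 powr (-m - 1))) * (a + 0 * (b \<bullet> \<tau>)))) (at 0)"
        unfolding g'_def
        by (intro DERIV_add DERIV_mult DERIV_cmult dp) (use Y in \<open>auto intro!: derivative_eq_intros\<close>)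
      also have "\<rho>' 0 = \<rho>" by (simp add: \<rho>'_def)
      also have "-m - 1 - 1 = -m - 2" by simp
      finally show ?thesis by (rule DERIV_cong) (simp add: l_def power2_eq_square algebra_simps)
    qed
    show ?thesis unfolding has_second_derivative_along_def
      using 1 2 Y by (intro exI[of _ g'] exI[of _ "norm Y"]) auto
  qed
  moreover have "(\<Sum>b\<in>Basis. l b) = 0"
  proof -
    have s1: "(\<Sum>b\<in>Basis. (Y \<bullet> b) * (b \<bullet> \<tau>)) = a"
      using euclidean_inner[of Y \<tau>] by (simp add: a_def inner_commute)
    have s2: "(\<Sum>b\<in>Basis. (Y \<bullet> b)\<^sup>2) = \<rho>"
      using euclidean_inner[of Y Y] by (simp add: \<rho>_def power2_eq_square)
    have s3: "\<rho> * \<rho> powr (-m - 2) = \<rho> powr (-m - 1)"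
    proof -
      have "\<rho> * \<rho> powr (-m - 2) = \<rho> powr (1 + (-m - 2))"
        using \<rho> by (subst powr_add) simp
      also have "1 + (-m - 2) = -m - 1" by simp
      finally show ?thesis .
    qed
    have "(\<Sum>b\<in>Basis. l b) = - 4 * m * \<rho> powr (-m - 1) * (\<Sum>b\<in>Basis. (Y \<bullet> b) * (b \<bullet> \<tau>))
      + 4 * m * (m + 1) * a * \<rho> powr (-m - 2) * (\<Sum>b\<in>Basis. (Y \<bullet> b)\<^sup>2) - 2 * m * (2 * m) * a * \<rho> powr (-m - 1)"
      unfolding l_def sum_subtractf sum.distrib sum_distrib_left by (simp add: m_def mult_ac)
    also have "\<dots> = 0" unfolding s1 s2 s3[symmetric] by (simp add: algebra_simps)
    finally show ?thesis .
  qed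
  ultimately show ?thesis unfolding has_laplacian_def by (intro exI[of _ l]) auto
qed

lemma continuous_on_halfspace_poisson: "continuous_on (- {0}) (halfspace_poisson \<tau>)"
  unfolding halfspace_poisson_def by (intro continuous_intros) auto

subsection \<open>Decay of the Poisson extension\<close>

text \<open>The set \<open>F\<close> comes from the tail of the norms of \<open>b\<close>, before
  any kernel \<open>k\<close> is given. One truncation thus serves all points and heights at once,
  and harmonicity and integration can be treated on finite sums.\<close>

lemma infsum_finite_approximation:
  fixes b :: "'i \<Rightarrow> complex"
  assumes b: "(\<lambda>i. norm (b i)) summable_on UNIV" and "\<eta> > 0"
  obtains F where "finite F" and
    "\<And>k A. (\<And>i. \<bar>k i\<bar> \<le> A) \<Longrightarrow> norm ((\<Sum>\<^sub>\<infinity>i. of_real (k i) * b i) - (\<Sum>i\<in>F. of_real (k i) * b i)) \<le> A * \<eta>"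
proof -
  let ?S = "\<Sum>\<^sub>\<infinity>i. norm (b i)"
  have "(sum (\<lambda>i. norm (b i)) \<longlongrightarrow> ?S) (finite_subsets_at_top UNIV)"
    using has_sum_infsum[OF b] by (simp add: has_sum_def)
  then have "\<forall>\<^sub>F F in finite_subsets_at_top UNIV. dist (\<Sum>i\<in>F. norm (b i)) ?S < \<eta>"
    using \<open>\<eta> > 0\<close> by (rule tendstoD)
  then obtain F where F: "finite F" "dist (\<Sum>i\<in>F. norm (b i)) ?S < \<eta>"
    unfolding eventually_finite_subsets_at_top by blast
  have split: "infsum f UNIV = sum f F + infsum f (- F)" if "f summable_on UNIV" for f :: "'i \<Rightarrow> 'c::banach"
    using infsum_Un_disjoint[of f F "- F"] F(1) summable_on_subset_banach[OF that]
    by (simp add: Compl_partition)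
  have tail: "(\<Sum>\<^sub>\<infinity>i\<in>-F. norm (b i)) \<le> \<eta>"
    using split[OF b] F(2) by (simp add: dist_real_def)
  have "norm ((\<Sum>\<^sub>\<infinity>i. of_real (k i) * b i) - (\<Sum>i\<in>F. of_real (k i) * b i)) \<le> A * \<eta>"
    if k: "\<And>i. \<bar>k i\<bar> \<le> A" for k A
  proof -
    have A: "A \<ge> 0" using k[of undefined] by linarith
    have le: "norm (of_real (k i) * b i) \<le> A * norm (b i)" for i
      using k[of i] by (simp add: norm_mult mult_right_mono)
    have sA: "(\<lambda>i. A * norm (b i)) summable_on T" for T
      using summable_on_cmult_right[OF summable_on_subset_banach[OF b]] by simp
    have abs: "(\<lambda>i. norm (of_real (k i) * b i)) summable_on T" for T
      by (rule summable_on_comparison_test[OF sA]) (use le in auto)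
    have "norm (\<Sum>\<^sub>\<infinity>i\<in>-F. of_real (k i) * b i) \<le> (\<Sum>\<^sub>\<infinity>i\<in>-F. norm (of_real (k i) * b i))"
      by (rule norm_infsum_bound) (rule abs)
    also have "\<dots> \<le> (\<Sum>\<^sub>\<infinity>i\<in>-F. A * norm (b i))"
      by (rule infsum_mono[OF abs sA le])
    also have "\<dots> = A * (\<Sum>\<^sub>\<infinity>i\<in>-F. norm (b i))" by (rule infsum_cmult_right')
    also have "\<dots> \<le> A * \<eta>" using tail A by (rule mult_left_mono)
    finally show ?thesis using split[OF abs_summable_summable[OF abs]] by simp
  qed
  with F(1) that show ?thesis by blast
qed

section \<open>The Poisson extension of a lattice sequence\<close>

definition lattice_point :: "int ^ 'n \<Rightarrow> real ^ 'n" where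
  "lattice_point j = (\<chi> k. real_of_int (j $ k))"

lemma lattice_point_diff: "lattice_point (i - j) = lattice_point i - lattice_point j"
  by (simp add: lattice_point_def vec_eq_iff)

text \<open>Unlike \<^const>\<open>poisson_kernel\<close>, this kernel does not vanish at the origin, where it is \<open>t\<^bsup>-n\<^esup>\<close>.\<close>

definition full_kernel :: "real ^ 'n \<Rightarrow> real \<Rightarrow> real" where
  "full_kernel x t = halfspace_poisson (0, 1) (x, t)"

lemma full_kernel_eq:
  "full_kernel (x :: real ^ 'n) t = t / (t\<^sup>2 + (norm x)\<^sup>2) powr ((real CARD('n) + 1) / 2)"
proof -
  have "(x, t) \<bullet> (x, t) = t\<^sup>2 + (norm x)\<^sup>2"
    using power2_norm_eq_inner[of x] by (simp add: power2_eq_square)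
  then show ?thesis by (simp add: full_kernel_def halfspace_poisson_def powr_minus_divide add.commute[of 1])
qed

lemma full_kernel_nonneg: "t \<ge> 0 \<Longrightarrow> full_kernel x t \<ge> 0"
  by (simp add: full_kernel_eq)

lemma full_kernel_le:
  fixes x :: "real ^ 'n"
  assumes "t > 0"
  shows "full_kernel x t \<le> t powr (- real CARD('n))"
proof -
  have "full_kernel x t \<le> t / (t\<^sup>2) powr ((real CARD('n) + 1) / 2)"
    unfolding full_kernel_eq using assms by (intro divide_left_mono powr_mono2) auto
  also have "(t\<^sup>2) powr ((real CARD('n) + 1) / 2) = t powr (real CARD('n) + 1)"
    using assms by (simp add: powr_powr add_divide_distrib flip: powr_numeral)
  also have "t / \<dots> = t powr (- real CARD('n))"
    using assms by (simp add: powr_add powr_minus field_simps)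
  finally show ?thesis .
qed

definition poisson_extension :: "(int ^ 'n \<Rightarrow> complex) \<Rightarrow> real ^ 'n \<Rightarrow> real \<Rightarrow> complex" where
  "poisson_extension b x t = (\<Sum>\<^sub>\<infinity>i. of_real (full_kernel (x - lattice_point i) t) * b i)"

lemma norm_poisson_extension_le:
  fixes b :: "int ^ 'n \<Rightarrow> complex"
  assumes b: "(\<lambda>i. norm (b i)) summable_on UNIV" and t: "t > 0"
  shows "norm (poisson_extension b x t) \<le> t powr (- real CARD('n)) * (\<Sum>\<^sub>\<infinity>i. norm (b i))"
proof -
  let ?A = "t powr (- real CARD('n))"
  have le: "norm (of_real (full_kernel (x - lattice_point i) t) * b i) \<le> ?A * norm (b i)" for i
    using full_kernel_le[OF t, of "x - lattice_point i"] full_kernel_nonneg[of t "x - lattice_point i"] t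
    by (simp add: norm_mult mult_right_mono)
  have sA: "(\<lambda>i. ?A * norm (b i)) summable_on UNIV"
    using summable_on_cmult_right[OF b] by simp
  have abs: "(\<lambda>i. norm (of_real (full_kernel (x - lattice_point i) t) * b i)) summable_on UNIV"
    by (rule summable_on_comparison_test[OF sA]) (use le in auto)
  have "norm (poisson_extension b x t) \<le> (\<Sum>\<^sub>\<infinity>i. norm (of_real (full_kernel (x - lattice_point i) t) * b i))"
    unfolding poisson_extension_def by (rule norm_infsum_bound) (rule abs)
  also have "\<dots> \<le> (\<Sum>\<^sub>\<infinity>i. ?A * norm (b i))" by (rule infsum_mono[OF abs sA le])
  also have "\<dots> = ?A * (\<Sum>\<^sub>\<infinity>i. norm (b i))" by (rule infsum_cmult_right')
  finally show ?thesis .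
qed

text \<open>Each summand is a translate of \<open>halfspace_poisson\<close>, hence harmonic in
  \<open>(x, t)\<close> at positive heights. The central difference estimate is applied on the cube
  of half-side \<open>t / 2\<close> about \<open>(x, t)\<close>, where heights are at least
  \<open>t / 2\<close>; the dimension \<open>n + 1\<close> yields the factor
  \<open>n + 2\<close>.\<close>

lemma finite_poisson_difference_le:
  fixes \<beta> :: "int ^ 'n \<Rightarrow> real" and x :: "real ^ 'n" and u :: "real ^ 'n \<Rightarrow> real \<Rightarrow> real"
  assumes u_def: "\<And>x t. u x t = (\<Sum>i\<in>F. \<beta> i * full_kernel (x - lattice_point i) t)"
    and t: "t > 0" and M: "M > 0" and uM: "\<And>x s. t / 2 \<le> s \<Longrightarrow> \<bar>u x s\<bar> \<le> M"
    and z: "0 \<le> z" "z \<le> t / 2"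
  shows "u (x + axis k z) t - u (x - axis k z) t \<le> 4 * M * (real CARD('n) + 2) * z / t"
proof -
  define v :: "(real ^ 'n) \<times> real \<Rightarrow> real" where "v = (\<lambda>X. \<Sum>i\<in>F. \<beta> i * halfspace_poisson (0, 1) ((- lattice_point i, 0) + X))"
  have v: "v (x, t) = u x t" for x t by (simp add: v_def u_def full_kernel_def)
  let ?e = "(axis k 1, 0) :: (real ^ 'n) \<times> real"
  have e: "?e \<in> Basis" by (simp add: Basis_prod_def axis_in_Basis_iff)
  have \<tau>: "(0, 1) \<in> (Basis :: ((real ^ 'n) \<times> real) set)" by (auto simp: Basis_prod_def)
  have near: "t / 2 \<le> snd X" if "\<And>b. b \<in> Basis \<Longrightarrow> \<bar>(X - (x, t)) \<bullet> b\<bar> \<le> t / 2" for X :: "(real ^ 'n) \<times> real"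
  proof -
    have "\<bar>snd X - t\<bar> \<le> t / 2" using that[OF \<tau>] by (simp add: inner_prod_def)
    then show ?thesis by linarith
  qed
  have nz: "(- lattice_point i, 0) + X \<noteq> 0" if "t / 2 \<le> snd X" for X :: "(real ^ 'n) \<times> real" and i
    using that t by (cases X) (auto simp: zero_prod_def)
  have "v ((x, t) + z *\<^sub>R ?e) - v ((x, t) - z *\<^sub>R ?e)
      \<le> 2 * M * (real DIM((real ^ 'n) \<times> real) + 1) * z / (t / 2)"
  proof (rule harmonic_central_difference_le[OF e _ M _ _ _ z])
    show "0 < t / 2" using t by simp
    show "continuous_on {X. \<forall>b\<in>Basis. \<bar>(X - (x, t)) \<bullet> b\<bar> \<le> t / 2} v"
      unfolding v_def
    proof (intro continuous_on_sum continuous_on_mult continuous_on_const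
        continuous_on_compose2[OF continuous_on_halfspace_poisson])
      fix i
      show "continuous_on {X. \<forall>b\<in>Basis. \<bar>(X - (x, t)) \<bullet> b\<bar> \<le> t / 2} (\<lambda>X. (- lattice_point i, 0) + X)"
        by (intro continuous_intros)
      show "(\<lambda>X. (- lattice_point i, 0) + X) ` {X. \<forall>b\<in>Basis. \<bar>(X - (x, t)) \<bullet> b\<bar> \<le> t / 2} \<subseteq> - {0}"
      proof (rule image_subsetI)
        fix X assume "X \<in> {X. \<forall>b\<in>Basis. \<bar>(X - (x, t)) \<bullet> b\<bar> \<le> t / 2}"
        then have "t / 2 \<le> snd X" by (intro near) simp
        then have "(- lattice_point i, 0) + X \<noteq> 0" by (rule nz)
        then show "(- lattice_point i, 0) + X \<in> - {0}" by blast
      qed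
    qed
  next
    fix X assume X: "\<And>b. b \<in> Basis \<Longrightarrow> \<bar>(X - (x, t)) \<bullet> b\<bar> \<le> t / 2"
    show "\<bar>v X\<bar> \<le> M" using uM[OF near[OF X]] v[of "fst X" "snd X"] by simp
    show "has_laplacian v X 0" unfolding v_def
    proof (rule has_laplacian_sum_zero)
      fix i
      have "has_laplacian (\<lambda>X. \<beta> i * halfspace_poisson (0, 1) ((- lattice_point i, 0) + X)) X (\<beta> i * 0)"
        by (intro has_laplacian_cmult has_laplacian_translate has_laplacian_halfspace_poisson \<tau>
            nz near X)
      then show "has_laplacian (\<lambda>X. \<beta> i * halfspace_poisson (0, 1) ((- lattice_point i, 0) + X)) X 0"
        by simp
    qed
  qed
  moreover have "z *\<^sub>R axis k (1::real) = axis k z" by (simp add: axis_def vec_eq_iff)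
  ultimately show ?thesis by (simp add: v algebra_simps)
qed

text \<open>Truncate to a finite sum with error \<open>\<eta>\<close> at all heights from
  \<open>t / 2\<close> on, take a real part, apply the finite estimate with
  \<open>M + \<eta>\<close>, and let \<open>\<eta>\<close> tend to 0.\<close>

lemma poisson_extension_difference_le:
  fixes b :: "int ^ 'n \<Rightarrow> complex" and x :: "real ^ 'n"
  assumes b: "(\<lambda>i. norm (b i)) summable_on UNIV" and t: "t > 0" and M: "M \<ge> 0"
    and UM: "\<And>x s. t / 2 \<le> s \<Longrightarrow> norm (poisson_extension b x s) \<le> M"
    and z: "0 \<le> z" "z \<le> t / 2"
  shows "norm (poisson_extension b (x + axis k z) t - poisson_extension b (x - axis k z) t)
    \<le> 4 * M * (real CARD('n) + 2) * z / t"
proof -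
  let ?U = "poisson_extension b"
  let ?n = "real CARD('n)"
  define D where "D = ?U (x + axis k z) t - ?U (x - axis k z) t"
  \<comment> \<open>A rotation taking \<open>D\<close> to its modulus, so that the real-valued
    estimate can be applied to \<open>Re (w * V x s)\<close>.\<close>
  define w where "w = (if D = 0 then 1 else cnj D / of_real (norm D))"
  have w: "norm w = 1" by (simp add: w_def norm_divide)
  have wD: "w * D = of_real (norm D)"
    using complex_norm_square[of D]
    by (simp add: w_def power2_eq_square mult.commute[of "cnj D"]) (metis nonzero_mult_div_cancel_left norm_eq_zero of_real_eq_0_iff)
  \<comment> \<open>From height \<open>t / 2\<close> on the kernel is at most \<open>A\<close>;
    truncating the norms of \<open>b\<close> to within \<open>\<eta> / A\<close> then costs at most
    \<open>\<eta>\<close>.\<close>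
  define A where "A = (t / 2) powr (- ?n)"
  have A: "A > 0" using t by (simp add: A_def)
  have approx: "norm D \<le> 4 * (M + \<eta>) * (?n + 2) * z / t + 2 * \<eta>" if \<eta>: "\<eta> > 0" for \<eta>
  proof -
    obtain F where F: "finite F" and
      Fb: "\<And>k B. (\<And>i. \<bar>k i\<bar> \<le> B) \<Longrightarrow> norm ((\<Sum>\<^sub>\<infinity>i. of_real (k i) * b i) - (\<Sum>i\<in>F. of_real (k i) * b i)) \<le> B * (\<eta> / A)"
      using infsum_finite_approximation[OF b, of "\<eta> / A"] \<eta> A by auto
    define V where "V x s = (\<Sum>i\<in>F. of_real (full_kernel (x - lattice_point i) s) * b i)" for x s
    have UV: "norm (?U x s - V x s) \<le> \<eta>" if s: "t / 2 \<le> s" for x s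
    proof -
      have "\<bar>full_kernel (x - lattice_point i) s\<bar> \<le> A" for i
      proof -
        have "full_kernel (x - lattice_point i) s \<le> s powr (- ?n)"
          using s t by (intro full_kernel_le) auto
        also have "\<dots> \<le> A" unfolding A_def using s t by (intro powr_mono2') auto
        finally show ?thesis using full_kernel_nonneg[of s "x - lattice_point i"] s t by simp
      qed
      from Fb[OF this] show ?thesis using A by (simp add: poisson_extension_def V_def)
    qed
    define \<beta> where "\<beta> i = Re (w * b i)" for i
    have \<beta>: "(\<Sum>i\<in>F. \<beta> i * full_kernel (x - lattice_point i) s) = Re (w * V x s)" for x s
      unfolding V_def \<beta>_def sum_distrib_left Re_sum by (intro sum.cong) (auto simp: algebra_simps)
    have "Re (w * V (x + axis k z) t) - Re (w * V (x - axis k z) t) \<le> 4 * (M + \<eta>) * (?n + 2) * z / t"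
      unfolding \<beta>[symmetric]
    proof (rule finite_poisson_difference_le[where F = F and \<beta> = \<beta>, OF refl t _ _ z])
      fix x s assume s: "t / 2 \<le> s"
      have "\<bar>Re (w * V x s)\<bar> \<le> norm (V x s)"
        using abs_Re_le_cmod[of "w * V x s"] by (simp add: norm_mult w)
      also have "\<dots> \<le> norm (?U x s) + norm (?U x s - V x s)"
        by (metis add.commute norm_minus_commute norm_triangle_sub)
      also have "\<dots> \<le> M + \<eta>" using UM[OF s] UV[OF s] by (intro add_mono)
      finally show "\<bar>\<Sum>i\<in>F. \<beta> i * full_kernel (x - lattice_point i) s\<bar> \<le> M + \<eta>" by (simp add: \<beta>)
    qed (use M \<eta> in simp)
    moreover have "norm D = Re (w * D)" by (simp add: wD)
    moreover have "\<bar>Re (w * (?U y t - V y t))\<bar> \<le> \<eta>" for y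
    proof -
      have "\<bar>Re (w * (?U y t - V y t))\<bar> \<le> norm (?U y t - V y t)"
        using abs_Re_le_cmod[of "w * (?U y t - V y t)"] by (simp add: norm_mult w)
      with UV[of t y] t show ?thesis by simp
    qed
    from this[of "x + axis k z"] this[of "x - axis k z"]
    have "\<bar>Re (w * ?U (x + axis k z) t) - Re (w * V (x + axis k z) t)\<bar> \<le> \<eta>"
      "\<bar>Re (w * ?U (x - axis k z) t) - Re (w * V (x - axis k z) t)\<bar> \<le> \<eta>"
      by (simp_all only: right_diff_distrib minus_complex.sel)
    moreover have "Re (w * D) = Re (w * ?U (x + axis k z) t) - Re (w * ?U (x - axis k z) t)"
      unfolding D_def by (simp only: right_diff_distrib minus_complex.sel)
    ultimately show ?thesis by linarith
  qed
  have "((\<lambda>\<eta>. 4 * (M + \<eta>) * (?n + 2) * z / t + 2 * \<eta>) \<longlongrightarrow> 4 * (M + 0) * (?n + 2) * z / t + 2 * 0) (at_right 0)"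
    using t by (intro tendsto_intros) auto
  then have "norm D \<le> 4 * (M + 0) * (?n + 2) * z / t + 2 * 0"
    by (rule tendsto_lowerbound) (use approx in \<open>auto intro!: eventually_at_rightI[of 0 1] simp del: distrib_left_numeral\<close>)
  then show ?thesis by (simp add: D_def)
qed

section \<open>Small values at lattice points and dyadic iteration\<close>

text \<open>The coordinates are changed one at a time, at cost \<open>L\<close> each.\<close>

lemma norm_diff_coordinatewise_le:
  fixes f :: "real ^ 'n \<Rightarrow> 'b::real_normed_vector" and x y :: "real ^ 'n"
  assumes step: "\<And>v k s. \<bar>s\<bar> \<le> \<delta> \<Longrightarrow> norm (f (v + axis k s) - f v) \<le> L"
    and xy: "\<And>k. \<bar>y $ k - x $ k\<bar> \<le> \<delta>"
  shows "norm (f y - f x) \<le> real CARD('n) * L"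
proof -
  have "norm (f (x + (\<Sum>k\<in>A. axis k (y $ k - x $ k))) - f x) \<le> real (card A) * L" for A :: "'n set"
  proof (induction A rule: infinite_finite_induct)
    case (insert k A)
    let ?v = "x + (\<Sum>k\<in>A. axis k (y $ k - x $ k))"
    have "norm (f (?v + axis k (y $ k - x $ k)) - f x) \<le> L + real (card A) * L"
      using norm_triangle_mono[OF step[OF xy, of ?v k k] insert.IH] by simp
    moreover have "x + (\<Sum>k\<in>insert k A. axis k (y $ k - x $ k)) = ?v + axis k (y $ k - x $ k)"
      using insert by (simp add: add_ac)
    ultimately show ?case
      using insert(1,2) by (metis add.commute card_insert_disjoint distrib_right mult_1 of_nat_Suc)
  qed auto
  from this[of UNIV] have "norm (f (x + (\<Sum>k\<in>UNIV. axis k (y $ k - x $ k))) - f x) \<le> real CARD('n) * L" .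
  moreover have "x + (\<Sum>k\<in>UNIV. axis k (y $ k - x $ k)) = y"
    by (simp add: vec_eq_iff axis_def)
  ultimately show ?thesis by simp
qed

text \<open>Pigeonhole: the box holds \<open>m ^ n\<close> lattice points, and if \<open>G\<close>
  exceeded the bound \<open>g\<close> at all of them, the \<open>p\<close>-th powers would sum to
  more than \<open>m ^ n * g powr p = H powr p\<close>.\<close>

lemma exists_small_value_in_box:
  fixes G :: "int ^ 'n \<Rightarrow> real" and x :: "real ^ 'n"
  assumes p: "p > 0" and H: "H \<ge> 0" and m: "m \<ge> 1"
    and GH: "\<And>A. finite A \<Longrightarrow> (\<Sum>j\<in>A. G j powr p) \<le> H powr p"
  obtains j where "\<And>k. \<bar>x $ k - lattice_point j $ k\<bar> \<le> real m"
    and "G j \<le> real m powr (- (real CARD('n) / p)) * H"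
proof (rule ccontr)
  assume con: "\<not> thesis"
  note found = that
  define g where "g = real m powr (- (real CARD('n) / p)) * H"
  \<comment> \<open>Exactly \<open>m\<close> integers, all between \<open>x $ k\<close> and
    \<open>x $ k + m\<close>.\<close>
  define I where "I k = {\<lfloor>x $ k\<rfloor> + 1..\<lfloor>x $ k\<rfloor> + int m}" for k
  define Y where "Y = vec_lambda ` (\<Pi>\<^sub>E k\<in>UNIV. I k)"
  have "inj_on vec_lambda (\<Pi>\<^sub>E k\<in>(UNIV :: 'n set). I k)"
    by (rule inj_onI) (metis vec_lambda_beta ext)
  moreover have "card (\<Pi>\<^sub>E k\<in>(UNIV :: 'n set). I k) = m ^ CARD('n)"
    by (simp add: card_PiE I_def)
  ultimately have card: "card Y = m ^ CARD('n)"
    unfolding Y_def by (simp add: card_image)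
  have fin: "finite Y" unfolding Y_def by (intro finite_imageI finite_PiE) (auto simp: I_def)
  have big: "g < G j" if j: "j \<in> Y" for j
  proof (rule ccontr)
    assume "\<not> g < G j"
    have "\<bar>x $ k - lattice_point j $ k\<bar> \<le> real m" for k
    proof -
      have "j $ k \<in> I k" using j by (auto simp: Y_def PiE_iff)
      then have "real_of_int \<lfloor>x $ k\<rfloor> + 1 \<le> real_of_int (j $ k)" "real_of_int (j $ k) \<le> real_of_int \<lfloor>x $ k\<rfloor> + real m"
        unfolding I_def by (auto; linarith)+
      then show ?thesis using m unfolding lattice_point_def by simp linarith
    qed
    with \<open>\<not> g < G j\<close> have thesis by (intro found) (auto simp: g_def)
    with con show False ..
  qed
  have g0: "g \<ge> 0" using H by (simp add: g_def)
  have "H powr p = real (card Y) * g powr p"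
  proof -
    have "g powr p = real m powr (- real CARD('n)) * H powr p"
      using p H by (simp add: g_def powr_mult powr_powr)
    moreover have "real (card Y) * real m powr (- real CARD('n)) = 1"
      using m by (simp add: card powr_minus powr_realpow)
    ultimately show ?thesis by (simp add: mult.assoc[symmetric])
  qed
  also have "\<dots> = (\<Sum>j\<in>Y. g powr p)" by simp
  also have "\<dots> < (\<Sum>j\<in>Y. G j powr p)"
  proof (rule sum_strict_mono[OF fin])
    show "Y \<noteq> {}" using card m fin by auto
    show "g powr p < G j powr p" if "j \<in> Y" for j
      using big[OF that] p g0 by (intro powr_less_mono2) auto
  qed
  also have "\<dots> \<le> H powr p" by (rule GH[OF fin])
  finally show False by simp
qed

text \<open>Induction over dyadic heights: on the scale \<open>\<epsilon> * t\<close>, the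
  oscillation and the value at a good lattice point each contribute half of the next bound. Later
  \<open>G\<close> is a multiple of the maximal function plus the modulus of \<open>b\<close>, and
  \<open>H\<close> a multiple of the Hardy norm.\<close>

lemma poisson_extension_decay:
  fixes p :: real
  assumes p: "p > 0"
  obtains C where "C > 0"
    and "\<And>(b :: int ^ 'n \<Rightarrow> complex) G H x t.
      (\<lambda>i. norm (b i)) summable_on UNIV \<Longrightarrow> (\<Sum>\<^sub>\<infinity>i. norm (b i)) \<le> H \<Longrightarrow>
      (\<And>A. finite A \<Longrightarrow> (\<Sum>j\<in>A. G j powr p) \<le> H powr p) \<Longrightarrow>
      (\<And>j t. t \<ge> 1 \<Longrightarrow> norm (poisson_extension b (lattice_point j) t) \<le> G j) \<Longrightarrow> t \<ge> 1 \<Longrightarrow>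
      norm (poisson_extension b x t) \<le> C * t powr (- (real CARD('n) / p)) * H"
proof -
  let ?n = "real CARD('n)"
  define \<nu> where "\<nu> = ?n / p"
  \<comment> \<open>Chosen so that the oscillation bound in the induction step comes out as
    \<open>(2 ^ Suc k) powr (- \<nu>) * H\<close>, half of what is sought.\<close>
  define \<epsilon> where "\<epsilon> = 1 / (4 * ?n * (?n + 2) * 2 powr \<nu>)"
  \<comment> \<open>Then \<open>t \<ge> 2 ^ Suc k * T\<close> gives
    \<open>\<epsilon> * t \<ge> 2 * 2 ^ Suc k\<close>, so that rounding down still leaves
    \<open>m \<ge> 2 ^ Suc k\<close>.\<close>
  define T where "T = 2 / \<epsilon>"
  have n: "?n \<ge> 1" by (simp add: Suc_le_eq)
  have \<nu>: "\<nu> > 0" using p by (simp add: \<nu>_def)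
  have \<epsilon>: "\<epsilon> > 0" using n by (simp add: \<epsilon>_def)
  have "1 * 1 * 1 \<le> 4 * ?n * (?n + 2) * 2 powr \<nu>"
    using n \<nu> by (intro mult_mono ge_one_powr_ge_zero; linarith?; simp?)
  then have \<epsilon>1: "\<epsilon> \<le> 1" by (simp add: \<epsilon>_def)
  have T: "T \<ge> 1" using \<epsilon> \<epsilon>1 by (simp add: T_def)
  \<comment> \<open>The factor \<open>2 * T\<close> pays for replacing \<open>t\<close> by the next
    lower \<open>2 ^ k * T\<close>; for \<open>t < T\<close> it makes the trivial bound
    \<open>H\<close> suffice.\<close>
  define C where "C = 2 * (2 * T) powr \<nu>"
  have main: "norm (poisson_extension b x t) \<le> C * t powr (- \<nu>) * H"
    if b: "(\<lambda>i. norm (b i)) summable_on UNIV" and bH: "(\<Sum>\<^sub>\<infinity>i. norm (b i)) \<le> H"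
      and GH: "\<And>A. finite A \<Longrightarrow> (\<Sum>j\<in>A. G j powr p) \<le> H powr p"
      and UG: "\<And>j t. t \<ge> 1 \<Longrightarrow> norm (poisson_extension b (lattice_point j) t) \<le> G j" and t: "t \<ge> 1"
    for b :: "int ^ 'n \<Rightarrow> complex" and G H x t
  proof -
    let ?U = "poisson_extension b"
    have "0 \<le> (\<Sum>\<^sub>\<infinity>i. norm (b i))" by (rule infsum_nonneg) simp
    then have H: "H \<ge> 0" using bH by linarith
    have trivial: "norm (?U x t) \<le> H" if t: "t \<ge> 1" for x t
    proof -
      have "norm (?U x t) \<le> t powr (- ?n) * (\<Sum>\<^sub>\<infinity>i. norm (b i))"
        using t by (intro norm_poisson_extension_le b) auto
      also have "\<dots> \<le> 1 * H"
        using t bH \<open>0 \<le> (\<Sum>\<^sub>\<infinity>i. norm (b i))\<close> powr_mono[of "- ?n" 0 t] by (intro mult_mono) auto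
      finally show ?thesis by simp
    qed
    have iter: "norm (?U x t) \<le> 2 * (2 ^ k) powr (- \<nu>) * H" if "t \<ge> 2 ^ k * T" for k x t
      using that
    proof (induction k arbitrary: x t)
      case 0
      then show ?case using trivial[of t x] T H by simp
    next
      case (Suc k)
      \<comment> \<open>The bound of the previous level. It holds at all heights from
        \<open>t / 2\<close> on, since these are at least \<open>2 ^ k * T\<close>.\<close>
      define M where "M = 2 * (2 ^ k) powr (- \<nu>) * H"
      have M: "M \<ge> 0" using H by (simp add: M_def)
      define m where "m = nat \<lfloor>\<epsilon> * t\<rfloor>"
      have et: "\<epsilon> * t \<ge> 2 * 2 ^ Suc k"
        using mult_left_mono[OF Suc.prems, of \<epsilon>] \<epsilon> by (simp add: T_def)
      have "(2::real) ^ Suc k \<ge> 1" by (rule one_le_power) simp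
      then have et2: "\<epsilon> * t \<ge> 2" using et by linarith
      have m: "real m \<le> \<epsilon> * t" "real m \<ge> 2 ^ Suc k" "m \<ge> 1"
        using et et2 \<open>(2::real) ^ Suc k \<ge> 1\<close> unfolding m_def by linarith+
      have t0: "t > 0" using et2 \<epsilon> by (smt (verit) mult_nonneg_nonpos)
      have mt: "real m \<le> t" using m(1) \<epsilon>1 t0 by (smt (verit) mult_left_le_one_le \<epsilon>)
      obtain j where j: "\<And>i. \<bar>x $ i - lattice_point j $ i\<bar> \<le> real m"
        and Gj: "G j \<le> real m powr (- \<nu>) * H"
        using exists_small_value_in_box[OF p H m(3) GH] unfolding \<nu>_def by metis
      have T1: "t \<ge> 1" using mt m(3) by linarith
      have "norm (?U x t - ?U (lattice_point j) t) \<le> ?n * (2 * M * (?n + 2) * real m / t)"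
      proof (rule norm_diff_coordinatewise_le[OF _ j])
        fix v :: "real ^ 'n" and i s assume s: "\<bar>s\<bar> \<le> real m"
        have *: "norm (?U (y + axis i z) t - ?U (y - axis i z) t) \<le> 4 * M * (?n + 2) * z / t"
          if "0 \<le> z" "z \<le> t / 2" for y z
        proof (rule poisson_extension_difference_le[OF b t0 M _ that])
          fix x' s assume "t / 2 \<le> s"
          then have "2 ^ k * T \<le> s" using Suc.prems by simp
          then show "norm (?U x' s) \<le> M" unfolding M_def by (rule Suc.IH)
        qed
        \<comment> \<open>A forward difference is a central one about the midpoint with half-width
          |s| / 2; the sign of \<open>s\<close> decides the orientation.\<close>
        have "norm (?U (v + axis i s) t - ?U v t) \<le> 4 * M * (?n + 2) * (\<bar>s\<bar> / 2) / t"
        proof (cases "s \<ge> 0")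
          case True
          have "v + axis i (s / 2) + axis i (s / 2) = v + axis i s" "v + axis i (s / 2) - axis i (s / 2) = v"
            by (auto simp: vec_eq_iff axis_def)
          with *[of "s / 2" "v + axis i (s / 2)"] show ?thesis using True s mt by (simp only:) simp
        next
          case False
          have "v + axis i (s / 2) + axis i (- s / 2) = v" "v + axis i (s / 2) - axis i (- s / 2) = v + axis i s"
            by (auto simp: vec_eq_iff axis_def)
          with *[of "- s / 2" "v + axis i (s / 2)"] show ?thesis
            using False s mt by (simp only:) (simp add: norm_minus_commute)
        qed
        also have "\<dots> = 2 * M * (?n + 2) * \<bar>s\<bar> / t" by simp
        also have "\<dots> \<le> 2 * M * (?n + 2) * real m / t"
          using t0 M s by (intro divide_right_mono mult_left_mono) auto
        finally show "norm (?U (v + axis i s) t - ?U v t) \<le> 2 * M * (?n + 2) * real m / t" .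
      qed
      also have "\<dots> = 2 * ?n * (?n + 2) * M * (real m / t)" by simp
      also have "\<dots> \<le> 2 * ?n * (?n + 2) * M * \<epsilon>"
        using m(1) t0 M by (intro mult_left_mono) (auto simp: field_simps)
      also have "\<dots> = (2 ^ Suc k) powr (- \<nu>) * H"
      proof -
        have "2 * ?n * (?n + 2) * 2 * \<epsilon> = 2 powr (- \<nu>)"
          using n by (simp add: \<epsilon>_def powr_minus_divide add_eq_0_iff)
        moreover have "2 * ?n * (?n + 2) * M * \<epsilon> = (2 * ?n * (?n + 2) * 2 * \<epsilon>) * (2 ^ k) powr (- \<nu>) * H"
          by (simp add: M_def)
        ultimately show ?thesis by (simp add: powr_mult)
      qed
      finally have "norm (?U x t - ?U (lattice_point j) t) \<le> (2 ^ Suc k) powr (- \<nu>) * H" .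
      moreover have "norm (?U (lattice_point j) t) \<le> (2 ^ Suc k) powr (- \<nu>) * H"
      proof -
        have "norm (?U (lattice_point j) t) \<le> real m powr (- \<nu>) * H" using UG[OF T1] Gj by (rule order_trans)
        also have "\<dots> \<le> (2 ^ Suc k) powr (- \<nu>) * H"
          using m(2) \<nu> H by (intro mult_right_mono powr_mono2') auto
        finally show ?thesis .
      qed
      ultimately show ?case
        using norm_triangle_ineq2[of "?U x t" "?U (lattice_point j) t"] by simp
    qed
    show ?thesis
    proof (cases "t < T")
      case True
      have "1 \<le> (2 * T / t) powr \<nu>" using True t \<nu> T by (intro ge_one_powr_ge_zero) auto
      then have "1 \<le> C * t powr (- \<nu>)"
      proof -
        have "(2 * T / t) powr \<nu> = (2 * T) powr \<nu> * t powr (- \<nu>)"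
          unfolding powr_divide powr_minus_divide by simp
        then show ?thesis using \<open>1 \<le> (2 * T / t) powr \<nu>\<close> unfolding C_def by linarith
      qed
      then show ?thesis using trivial[OF t, of x] H mult_right_mono[of 1 "C * t powr (- \<nu>)" H] by simp
    next
      case False
      define y where "y = t / T"
      have y: "y \<ge> 1" using False T by (simp add: y_def)
      \<comment> \<open>The least power of two above \<open>t / T\<close>; its predecessor satisfies
        \<open>2 ^ k * T \<le> t < 2 ^ Suc k * T\<close>.\<close>
      define l where "l = (LEAST l. y < 2 ^ l)"
      have l: "y < 2 ^ l" unfolding l_def using real_arch_pow[of 2 y] by (auto intro: LeastI_ex)
      then have "l \<noteq> 0" using y by (cases l) auto
      then obtain k where k: "l = Suc k" by (cases l) auto
      have "\<not> y < 2 ^ k" using not_less_Least[of k "\<lambda>l. y < 2 ^ l"] k by (simp add: l_def)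
      then have "2 ^ k * T \<le> t" using T by (simp add: y_def field_simps)
      then have "norm (?U x t) \<le> 2 * (2 ^ k) powr (- \<nu>) * H" by (rule iter)
      also have "\<dots> \<le> 2 * (t / (2 * T)) powr (- \<nu>) * H"
        using l k T t \<nu> H by (intro mult_right_mono mult_left_mono powr_mono2') (auto simp: y_def field_simps)
      also have "\<dots> = C * t powr (- \<nu>) * H"
        using t T by (simp add: C_def powr_divide powr_minus field_simps)
      finally show ?thesis .
    qed
  qed
  show ?thesis
  proof (rule that)
    show "C > 0" using T by (simp add: C_def)
  qed (rule main[unfolded \<nu>_def], assumption+)
qed

subsection \<open>The Riesz potential as an integral of Poisson averages\<close>

text \<open>Substituting \<open>t = r * s\<close> extracts the power of \<open>r\<close>, and
  \<open>\<kappa>\<close> is the integral at \<open>r = 1\<close>. It converges because the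
  integrand is at most \<open>t powr \<alpha>\<close> near 0 and
  \<open>t powr (\<alpha> - 2 * \<beta>)\<close> at infinity, an exponent below -1.\<close>

lemma has_integral_powr_div_powr_scaling:
  fixes \<alpha> \<beta> :: real
  assumes \<alpha>: "0 < \<alpha>" and \<beta>: "\<alpha> + 1 < 2 * \<beta>"
  obtains \<kappa> where "\<kappa> > 0" and
    "\<And>r. r > 0 \<Longrightarrow> ((\<lambda>t. t powr \<alpha> / (t\<^sup>2 + r\<^sup>2) powr \<beta>) has_integral \<kappa> * r powr (\<alpha> + 1 - 2 * \<beta>)) {0..}"
proof -
  define f where "f r t = t powr \<alpha> / (t\<^sup>2 + r\<^sup>2) powr \<beta>" for r t :: real
  \<comment> \<open>Extended by 0 to the whole line, where the linear substitution for the Bochner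
    integral applies.\<close>
  define \<phi> where "\<phi> r t = indicator {0..} t * f r t" for r t :: real
  have b0: "\<beta> > 0" using assms by simp
  have meas: "(\<lambda>t. f r t) \<in> borel_measurable borel" for r unfolding f_def by measurable
  have int1: "f 1 integrable_on {0..1}"
  proof (rule measurable_bounded_by_integrable_imp_integrable)
    show "f 1 \<in> borel_measurable (lebesgue_on {0..1})"
      using meas[of 1] by (intro measurable_restrict_space1 measurable_completion) simp
    show "(\<lambda>t. t powr \<alpha>) integrable_on {0..1}" using \<alpha> by (intro integrable_on_powr_from_0) auto
    fix t :: real
    have "(t\<^sup>2 + 1\<^sup>2) powr \<beta> \<ge> 1" using b0 by (intro ge_one_powr_ge_zero) auto
    then show "norm (f 1 t) \<le> t powr \<alpha>"
      by (simp add: f_def divide_le_eq mult_le_cancel_left1 del: one_power2)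
  qed auto
  have int2: "f 1 integrable_on {1..}"
  proof (rule measurable_bounded_by_integrable_imp_integrable)
    show "f 1 \<in> borel_measurable (lebesgue_on {1..})"
      using meas[of 1] by (intro measurable_restrict_space1 measurable_completion) simp
    show "(\<lambda>t::real. t powr (\<alpha> - 2 * \<beta>)) integrable_on {1..}"
      using has_integral_powr_to_inf[of "\<alpha> - 2 * \<beta>" 1] \<beta> by (auto simp: integrable_on_def)
    fix t :: real assume t: "t \<in> {1..}"
    have "f 1 t \<le> t powr \<alpha> / (t\<^sup>2) powr \<beta>" unfolding f_def
      using t b0 by (intro divide_left_mono powr_mono2 mult_pos_pos) (auto simp: add_nonneg_eq_0_iff)
    also have "(t\<^sup>2) powr \<beta> = t powr (2 * \<beta>)" using t by (simp add: powr_powr flip: powr_numeral)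
    also have "t powr \<alpha> / \<dots> = t powr (\<alpha> - 2 * \<beta>)" using t by (simp add: powr_diff)
    finally show "norm (f 1 t) \<le> t powr (\<alpha> - 2 * \<beta>)" by (simp add: f_def)
  qed auto
  have int: "f 1 integrable_on {0..}"
  proof -
    have "f 1 integrable_on ({0..1} \<union> {1..})"
      by (rule integrable_Un[OF _ int1 int2]) (simp add: Int_atLeastAtMostR2)
    moreover have "{0..1} \<union> {1..} = {0::real..}" by auto
    ultimately show ?thesis by simp
  qed
  have nn: "f r t \<ge> 0" for r t by (simp add: f_def)
  define \<kappa> where "\<kappa> = integral {0..} (f 1)"
  have "\<kappa> > 0"
  proof -
    have *: "1 / 5 powr \<beta> \<le> f 1 t" if "t \<in> {1..2}" for t
    proof -
      have "t\<^sup>2 \<le> 2\<^sup>2" using that by (intro power_mono) auto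
      then have "1 / 5 powr \<beta> \<le> 1 / (t\<^sup>2 + 1\<^sup>2) powr \<beta>"
        using b0 by (intro divide_left_mono powr_mono2) (auto simp: add_nonneg_eq_0_iff)
      also have "\<dots> \<le> f 1 t" unfolding f_def using that \<alpha>
        by (intro divide_right_mono ge_one_powr_ge_zero) auto
      finally show ?thesis .
    qed
    have i12: "f 1 integrable_on {1..2}"
      using integrable_on_subinterval[OF int, of 1 2] by auto
    have "0 < 1 / 5 powr \<beta>" by simp
    also have "1 / 5 powr \<beta> = integral {1..2::real} (\<lambda>t. 1 / 5 powr \<beta>)" by simp
    also have "\<dots> \<le> integral {1..2} (f 1)"
      by (intro integral_le i12 integrable_const_ivl *)
    also have "\<dots> \<le> \<kappa>" unfolding \<kappa>_def
      by (rule integral_subset_le[OF _ i12 int]) (auto simp: nn)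
    finally show ?thesis .
  qed
  have "\<phi> 1 integrable_on UNIV" and eq: "integral UNIV (\<phi> 1) = \<kappa>"
  proof -
    have "\<phi> 1 = (\<lambda>t. if t \<in> {0..} then f 1 t else 0)" by (auto simp: \<phi>_def)
    then show "\<phi> 1 integrable_on UNIV" "integral UNIV (\<phi> 1) = \<kappa>"
      using int by (simp_all only: integrable_restrict_UNIV integral_restrict_UNIV \<kappa>_def)
  qed
  then have hi: "(\<phi> 1 has_integral \<kappa>) UNIV" by (metis integrable_integral)
  have m\<phi>: "\<phi> 1 \<in> borel_measurable borel" unfolding \<phi>_def using meas[of 1] by measurable
  have bi: "has_bochner_integral lborel (\<phi> 1) \<kappa>"
    using hi m\<phi> \<open>\<kappa> > 0\<close> nn
    by (auto intro!: has_bochner_integral_nn_integral nn_integral_has_integral_lborel[OF m\<phi> _ hi] simp: \<phi>_def)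
  have "(f r has_integral \<kappa> * r powr (\<alpha> + 1 - 2 * \<beta>)) {0..}" if r: "r > 0" for r
  proof -
    have scale: "\<phi> r t = r powr (\<alpha> - 2 * \<beta>) * \<phi> 1 (0 + (1 / r) * t)" for t
    proof (cases "t \<ge> 0")
      case True
      have "(t / r)\<^sup>2 + 1\<^sup>2 = (t\<^sup>2 + r\<^sup>2) / r\<^sup>2" using r by (simp add: field_simps)
      then have "f 1 (t / r) = (t powr \<alpha> / r powr \<alpha>) / ((t\<^sup>2 + r\<^sup>2) powr \<beta> / (r\<^sup>2) powr \<beta>)"
        using True r by (simp only: f_def powr_divide)
      also have "(r\<^sup>2) powr \<beta> = r powr (2 * \<beta>)" using r by (simp add: powr_powr flip: powr_numeral)
      finally have "r powr (\<alpha> - 2 * \<beta>) * f 1 (t / r) = f r t"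
        using r by (simp add: f_def powr_diff)
      then show ?thesis using True r by (simp add: \<phi>_def)
    qed (use r in \<open>auto simp: \<phi>_def zero_le_divide_iff\<close>)
    have "has_bochner_integral lborel (\<lambda>t. \<phi> 1 (0 + (1 / r) * t)) (\<kappa> /\<^sub>R \<bar>1 / r\<bar>)"
      using bi r by (subst lborel_has_bochner_integral_real_affine_iff[symmetric]) auto
    then have "has_bochner_integral lborel (\<phi> r) (r powr (\<alpha> - 2 * \<beta>) * (\<kappa> /\<^sub>R \<bar>1 / r\<bar>))"
      unfolding scale by (rule has_bochner_integral_mult_right)
    also have "r powr (\<alpha> - 2 * \<beta>) * (\<kappa> /\<^sub>R \<bar>1 / r\<bar>) = \<kappa> * r powr (\<alpha> + 1 - 2 * \<beta>)"
      using r by (simp add: powr_add powr_diff)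
    finally have "(\<phi> r has_integral \<kappa> * r powr (\<alpha> + 1 - 2 * \<beta>)) UNIV"
      using has_integral_integral_lborel[of "\<phi> r"] by (simp add: has_bochner_integral_iff)
    moreover have "\<phi> r = (\<lambda>t. if t \<in> {0..} then f r t else 0)" by (auto simp: \<phi>_def)
    ultimately show ?thesis by (simp only: has_integral_restrict_UNIV)
  qed
  with \<open>\<kappa> > 0\<close> show ?thesis using that unfolding f_def by blast
qed

section \<open>Kernel bounds on the lattice\<close>

lemma znorm_eq: "znorm j = norm (lattice_point j)"
  by (simp add: znorm_def lattice_point_def)

lemma znorm_ge_1:
  assumes "j \<noteq> 0"
  shows "znorm j \<ge> 1"
proof -
  obtain k where "j $ k \<noteq> 0" using assms by (auto simp: vec_eq_iff)
  then have "1 \<le> \<bar>lattice_point j $ k\<bar>" by (simp add: lattice_point_def)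
  also have "\<dots> \<le> norm (lattice_point j)" by (rule component_le_norm_cart)
  finally show ?thesis by (simp add: znorm_eq)
qed

lemma poisson_kernel_eq:
  "poisson_kernel c t j = (if j = 0 then 0 else c * full_kernel (lattice_point j) t)"
  by (simp add: poisson_kernel_def full_kernel_eq znorm_eq)

text \<open>Nonzero lattice points have norm at least 1, so the denominator dominates
  \<open>t^2 + 1\<close> and hence \<open>t\<close>. Unlike \<open>t powr (- n)\<close>, this bound
  stays finite as \<open>t\<close> tends to 0.\<close>

lemma full_kernel_lattice_le_1:
  fixes j :: "int ^ 'n"
  assumes "t > 0" "j \<noteq> 0"
  shows "full_kernel (lattice_point j) t \<le> 1"
proof -
  let ?r = "t\<^sup>2 + (norm (lattice_point j))\<^sup>2"
  have "(norm (lattice_point j))\<^sup>2 \<ge> 1" using znorm_ge_1[OF assms(2)] by (simp add: znorm_eq)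
  then have r: "?r \<ge> t\<^sup>2 + 1" by simp
  have "t \<le> ?r" 
  proof -
    have "0 \<le> (t - 1)\<^sup>2" by simp
    also have "\<dots> = t\<^sup>2 - 2 * t + 1" by (simp add: power2_diff)
    finally show ?thesis using r \<open>t > 0\<close> by linarith
  qed
  also have "\<dots> = ?r powr 1" using r by (simp add: add_pos_nonneg assms)
  also have "\<dots> \<le> ?r powr ((real CARD('n) + 1) / 2)"
  proof (rule powr_mono)
    have "real CARD('n) \<ge> 1" by (simp add: Suc_le_eq)
    then show "1 \<le> (real CARD('n) + 1) / 2" by simp
    show "1 \<le> ?r" using r zero_le_power2[of t] by linarith
  qed
  finally have "t \<le> ?r powr ((real CARD('n) + 1) / 2)" .
  moreover have "?r powr ((real CARD('n) + 1) / 2) > 0" using calculation \<open>t > 0\<close> by linarith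
  ultimately show ?thesis by (simp add: full_kernel_eq)
qed

text \<open>Split off the term \<open>i = j\<close>: it carries the value of
  \<open>full_kernel\<close> at the origin, where \<open>poisson_kernel\<close> is set to 0.\<close>

lemma poisson_extension_lattice_eq:
  fixes b :: "int ^ 'n \<Rightarrow> complex"
  assumes b: "(\<lambda>i. norm (b i)) summable_on UNIV" and t: "t > 0" and c: "c \<noteq> 0"
  shows "of_real c * poisson_extension b (lattice_point j) t
    = zconv (poisson_kernel c t) b j + of_real (c * full_kernel (0 :: real ^ 'n) t) * b j"
proof -
  let ?k = "\<lambda>i. of_real (full_kernel (lattice_point j - lattice_point i) t) * b i"
  let ?A = "t powr (- real CARD('n))"
  have le: "norm (?k i) \<le> norm (?A * norm (b i))" for i
    using full_kernel_le[OF t, of "lattice_point j - lattice_point i"]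
      full_kernel_nonneg[of t "lattice_point j - lattice_point i"] t
    by (simp add: norm_mult mult_right_mono)
  have "(\<lambda>i. ?A * norm (b i)) summable_on UNIV" using summable_on_cmult_right[OF b] by simp
  then have "(\<lambda>i. norm (?k i)) summable_on UNIV"
    by (intro Infinite_Sum.abs_summable_on_comparison_test[OF _ le]) (simp add: abs_mult)
  then have "?k summable_on UNIV" by (rule abs_summable_summable)
  then have k: "?k summable_on T" for T by (rule summable_on_subset_banach) simp
  have "infsum ?k UNIV = infsum ?k {j} + infsum ?k (UNIV - {j})"
    using infsum_Un_disjoint[OF k k, of "{j}" "UNIV - {j}"] by (simp add: Un_commute)
  moreover have "of_real c * infsum ?k (UNIV - {j}) = zconv (poisson_kernel c t) b j"
    unfolding zconv_def infsum_cmult_right'[symmetric]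
    by (rule infsum_cong_neutral) (auto simp: poisson_kernel_eq lattice_point_diff)
  ultimately show ?thesis
    unfolding poisson_extension_def by (simp add: distrib_left)
qed

text \<open>Integrating \<open>t powr (\<alpha> - 1) * poisson_kernel c t j\<close> over
  \<open>t\<close> gives a multiple of the Riesz kernel. Sum and integral are interchanged on a
  finite truncation, and the integral is split at \<open>T\<close>, with the bound \<open>M\<close>
  below and the decay bound above.\<close>

lemma norm_riesz_potential_le:
  assumes c: "c > 0" and \<alpha>: "0 < \<alpha>" "\<alpha> < real CARD('n::finite)"
  obtains \<kappa> where "\<kappa> > 0" and
    "\<And>(b :: int ^ 'n \<Rightarrow> complex) j M B D \<nu> T.
      (\<lambda>i. norm (b i)) summable_on UNIV \<Longrightarrow>
      (\<And>t. t > 0 \<Longrightarrow> norm (zconv (poisson_kernel c t) b j) \<le> M) \<Longrightarrow>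
      (\<And>t. t \<ge> 1 \<Longrightarrow> norm (zconv (poisson_kernel c t) b j) \<le> B * t powr (- \<nu>) + D * t powr (- real CARD('n))) \<Longrightarrow>
      \<nu> > \<alpha> \<Longrightarrow> T \<ge> 1 \<Longrightarrow>
      \<kappa> * norm (riesz_potential \<alpha> b j)
        \<le> M * T powr \<alpha> / \<alpha> + B * T powr (\<alpha> - \<nu>) / (\<nu> - \<alpha>) + D * T powr (\<alpha> - real CARD('n)) / (real CARD('n) - \<alpha>)"
proof -
  let ?n = "real CARD('n)"
  \<comment> \<open>With \<open>\<beta> = (n + 1) / 2\<close> the resulting power of
    \<open>r\<close> is \<open>\<alpha> - n\<close>, and the convergence condition is
    \<open>\<alpha> < n\<close>.\<close>
  obtain \<kappa> where \<kappa>: "\<kappa> > 0" and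
    int: "\<And>r. r > 0 \<Longrightarrow> ((\<lambda>t. t powr \<alpha> / (t\<^sup>2 + r\<^sup>2) powr ((?n + 1) / 2)) has_integral
        \<kappa> * r powr (\<alpha> + 1 - 2 * ((?n + 1) / 2))) {0..}"
    using has_integral_powr_div_powr_scaling[of \<alpha> "(?n + 1) / 2"] \<alpha> by auto
  have intk: "((\<lambda>t. t powr (\<alpha> - 1) * poisson_kernel c t j) has_integral
      c * \<kappa> * (if j = 0 then 0 else znorm j powr (\<alpha> - ?n))) {0..}" for j :: "int ^ 'n"
  proof (cases "j = 0")
    case False
    have z: "znorm j > 0" using znorm_ge_1[OF False] by simp
    have e: "t powr (\<alpha> - 1) * poisson_kernel c t j = c * (t powr \<alpha> / (t\<^sup>2 + (znorm j)\<^sup>2) powr ((?n + 1) / 2))"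
      if "t \<in> {0..}" for t
    proof (cases "t = 0")
      case False
      then have "t powr (\<alpha> - 1) * t = t powr \<alpha>" using that by (simp add: powr_diff)
      then show ?thesis using \<open>j \<noteq> 0\<close> unfolding poisson_kernel_def by (simp add: field_simps)
    qed (use \<alpha> in \<open>simp add: poisson_kernel_def\<close>)
    have "((\<lambda>t. c * (t powr \<alpha> / (t\<^sup>2 + (znorm j)\<^sup>2) powr ((?n + 1) / 2))) has_integral
        c * (\<kappa> * znorm j powr (\<alpha> + 1 - 2 * ((?n + 1) / 2)))) {0..}"
      by (rule has_integral_mult_right[OF int[OF z]])
    then have "((\<lambda>t. t powr (\<alpha> - 1) * poisson_kernel c t j) has_integral
        c * (\<kappa> * znorm j powr (\<alpha> + 1 - 2 * ((?n + 1) / 2)))) {0..}"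
      by (rule has_integral_eq[rotated]) (simp only: e)
    moreover have "\<alpha> + 1 - 2 * ((?n + 1) / 2) = \<alpha> - ?n" by (simp add: field_simps)
    ultimately show ?thesis using False by (simp only: if_False mult.assoc)
  qed (simp add: poisson_kernel_def)
  have main: "c * \<kappa> * norm (riesz_potential \<alpha> b j)
      \<le> M * T powr \<alpha> / \<alpha> + B * T powr (\<alpha> - \<nu>) / (\<nu> - \<alpha>) + D * T powr (\<alpha> - ?n) / (?n - \<alpha>)"
    if b: "(\<lambda>i. norm (b i)) summable_on UNIV"
      and WM: "\<And>t. t > 0 \<Longrightarrow> norm (zconv (poisson_kernel c t) b j) \<le> M"
      and WB: "\<And>t. t \<ge> 1 \<Longrightarrow> norm (zconv (poisson_kernel c t) b j) \<le> B * t powr (- \<nu>) + D * t powr (- ?n)"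
      and \<nu>: "\<nu> > \<alpha>" and T: "T \<ge> 1"
    for b :: "int ^ 'n \<Rightarrow> complex" and j M B D \<nu> T
  proof -
    define k where "k i = (if i = j then 0 else znorm (i - j) powr (\<alpha> - ?n))" for i
    have kI: "riesz_potential \<alpha> b j = (\<Sum>\<^sub>\<infinity>i. of_real (k i) * b i)"
      unfolding riesz_potential_def
    proof (rule infsum_cong_neutral)
      fix i assume "i \<in> (UNIV - {j}) \<inter> UNIV"
      then show "b i / of_real (znorm (i - j) powr (?n - \<alpha>)) = of_real (k i) * b i"
        using powr_minus_divide[of "znorm (i - j)" "?n - \<alpha>"] by (simp add: k_def)
    qed (auto simp: k_def)
    have k1: "\<bar>k i\<bar> \<le> 1" for i
    proof (cases "i = j")
      case False
      then have "znorm (i - j) powr (\<alpha> - ?n) \<le> znorm (i - j) powr 0"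
        using \<alpha> znorm_ge_1[of "i - j"] by (intro powr_mono) auto
      then show ?thesis using False znorm_ge_1[of "i - j"] by (auto simp: k_def)
    qed (simp add: k_def)
    have znorm_sym: "znorm (j - i) = znorm (i - j)" for i
      by (simp add: znorm_eq lattice_point_diff norm_minus_commute)
    have "c * \<kappa> * norm (riesz_potential \<alpha> b j)
        \<le> c * \<kappa> * \<eta> + (M + c * \<eta>) * T powr \<alpha> / \<alpha> + B * T powr (\<alpha> - \<nu>) / (\<nu> - \<alpha>)
           + (D + c * \<eta>) * T powr (\<alpha> - ?n) / (?n - \<alpha>)" if \<eta>: "\<eta> > 0" for \<eta>
    proof -
      obtain F where F: "finite F" and
        Fb: "\<And>k A. (\<And>i. \<bar>k i\<bar> \<le> A) \<Longrightarrow> norm ((\<Sum>\<^sub>\<infinity>i. of_real (k i) * b i) - (\<Sum>i\<in>F. of_real (k i) * b i)) \<le> A * \<eta>"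
        using infsum_finite_approximation[OF b \<eta>] by blast
      define W where "W t = (\<Sum>i\<in>F. of_real (poisson_kernel c t (j - i)) * b i)" for t
      define g where "g t = (\<Sum>i\<in>F. of_real (t powr (\<alpha> - 1) * poisson_kernel c t (j - i)) * b i)" for t
      have gW: "g t = of_real (t powr (\<alpha> - 1)) * W t" for t
        by (simp add: g_def W_def sum_distrib_left mult.assoc)
      \<comment> \<open>Two error bounds: the constant one is integrable against
        \<open>t powr (\<alpha> - 1)\<close> near 0, the decaying one at infinity because
        \<open>\<alpha> < n\<close>.\<close>
      have diff: "norm (zconv (poisson_kernel c t) b j - W t) \<le> c * \<eta>"
        "norm (zconv (poisson_kernel c t) b j - W t) \<le> c * \<eta> * t powr (- ?n)" if t: "t > 0" for t
      proof -
        have "\<bar>poisson_kernel c t (j - i)\<bar> \<le> c * 1" for i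
          using full_kernel_lattice_le_1[OF t, of "j - i"] c t full_kernel_nonneg[of t "lattice_point (j - i)"]
          by (auto simp: poisson_kernel_eq abs_mult)
        from Fb[OF this] show "norm (zconv (poisson_kernel c t) b j - W t) \<le> c * \<eta>"
          by (simp add: zconv_def W_def)
        have "\<bar>poisson_kernel c t (j - i)\<bar> \<le> c * t powr (- ?n)" for i
          using full_kernel_le[OF t, of "lattice_point (j - i)"] c t full_kernel_nonneg[of t "lattice_point (j - i)"]
          by (auto simp: poisson_kernel_eq abs_mult)
        from Fb[OF this] show "norm (zconv (poisson_kernel c t) b j - W t) \<le> c * \<eta> * t powr (- ?n)"
          by (simp add: zconv_def W_def mult_ac)
      qed
      have WM': "norm (W t) \<le> M + c * \<eta>" if "t > 0" for t
        using norm_triangle_sub[of "W t" "zconv (poisson_kernel c t) b j"] WM[OF that] diff(1)[OF that]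
        by (simp add: norm_minus_commute)
      have WB': "norm (W t) \<le> B * t powr (- \<nu>) + (D + c * \<eta>) * t powr (- ?n)" if "t \<ge> 1" for t
        using norm_triangle_sub[of "W t" "zconv (poisson_kernel c t) b j"] WB[OF that] diff(2)[of t] that
        by (simp add: norm_minus_commute distrib_right)
      \<comment> \<open>Nonnegativity gives absolute integrability, which passes to the pieces
        \<open>{0..T}\<close> and \<open>{T..}\<close>.\<close>
      have abs: "(\<lambda>t. t powr (\<alpha> - 1) * poisson_kernel c t i) absolutely_integrable_on {0..}" for i :: "int ^ 'n"
        using intk[of i] c by (intro nonnegative_absolutely_integrable_1) (auto simp: poisson_kernel_def)
      have gint: "g integrable_on S" if "S \<in> sets lebesgue" "S \<subseteq> {0..}" for S
      proof -
        have "(\<lambda>t. t powr (\<alpha> - 1) * poisson_kernel c t i) integrable_on S" for i :: "int ^ 'n"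
          using set_integrable_subset[OF abs that] set_lebesgue_integral_eq_integral(1) by blast
        from has_integral_of_real[OF integrable_integral[OF this]]
        have "(\<lambda>t. of_real (t powr (\<alpha> - 1) * poisson_kernel c t (j - i)) * b i) integrable_on S" for i
          by (intro integrable_on_mult_left has_integral_integrable)
        then show ?thesis unfolding g_def by (intro integrable_sum F) auto
      qed
      have "(g has_integral (\<Sum>i\<in>F. of_real (c * \<kappa> * (if j - i = 0 then 0 else znorm (j - i) powr (\<alpha> - ?n))) * b i)) {0..}"
        unfolding g_def by (intro has_integral_sum F has_integral_mult_left has_integral_of_real intk)
      also have "(\<Sum>i\<in>F. of_real (c * \<kappa> * (if j - i = 0 then 0 else znorm (j - i) powr (\<alpha> - ?n))) * b i)
          = of_real (c * \<kappa>) * (\<Sum>i\<in>F. of_real (k i) * b i)"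
        unfolding sum_distrib_left
      proof (rule sum.cong[OF refl])
        fix i
        show "of_real (c * \<kappa> * (if j - i = 0 then 0 else znorm (j - i) powr (\<alpha> - ?n))) * b i
            = of_real (c * \<kappa>) * (of_real (k i) * b i)"
          using znorm_sym[of i] by (simp add: k_def)
      qed
      finally have gI: "integral {0..} g = of_real (c * \<kappa>) * (\<Sum>i\<in>F. of_real (k i) * b i)"
        by (rule integral_unique)
      have split: "integral {0..} g = integral {0..T} g + integral {T..} g"
      proof -
        have "{0..T} \<union> {T..} = {0..}" using T by auto
        moreover have "negligible ({0..T} \<inter> {T..})" using T by (simp add: Int_atLeastAtMostR2)
        ultimately show ?thesis
          using integral_Un[OF gint gint, of "{0..T}" "{T..}"] T by auto
      qed
      have low: "norm (integral {0..T} g) \<le> (M + c * \<eta>) * (T powr (\<alpha> - 1 + 1) / (\<alpha> - 1 + 1))"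
      proof -
        have hi: "((\<lambda>t. (M + c * \<eta>) * t powr (\<alpha> - 1)) has_integral (M + c * \<eta>) * (T powr (\<alpha> - 1 + 1) / (\<alpha> - 1 + 1))) {0..T}"
          using \<alpha> T by (intro has_integral_mult_right has_integral_powr_from_0) auto
        have "norm (integral {0..T} g) \<le> integral {0..T} (\<lambda>t. (M + c * \<eta>) * t powr (\<alpha> - 1))"
        proof (rule Henstock_Kurzweil_Integration.integral_norm_bound_integral)
          show "norm (g t) \<le> (M + c * \<eta>) * t powr (\<alpha> - 1)" if "t \<in> {0..T}" for t
          proof (cases "t = 0")
            case False
            then show ?thesis using WM'[of t] that by (simp add: gW norm_mult mult.commute mult_left_mono)
          qed (simp add: gW)
        qed (use gint hi in \<open>auto simp: integrable_on_def\<close>)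
        with integral_unique[OF hi] show ?thesis by simp
      qed
      have high: "norm (integral {T..} g) \<le> B * (- (T powr (\<alpha> - 1 - \<nu> + 1)) / (\<alpha> - 1 - \<nu> + 1))
          + (D + c * \<eta>) * (- (T powr (\<alpha> - 1 - ?n + 1)) / (\<alpha> - 1 - ?n + 1))" (is "_ \<le> ?R")
      proof -
        have hi: "((\<lambda>t. B * t powr (\<alpha> - 1 - \<nu>) + (D + c * \<eta>) * t powr (\<alpha> - 1 - ?n)) has_integral ?R) {T..}"
          using \<alpha> T \<nu> by (intro has_integral_add has_integral_mult_right has_integral_powr_to_inf) auto
        have "norm (integral {T..} g) \<le> integral {T..} (\<lambda>t. B * t powr (\<alpha> - 1 - \<nu>) + (D + c * \<eta>) * t powr (\<alpha> - 1 - ?n))"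
        proof (rule Henstock_Kurzweil_Integration.integral_norm_bound_integral)
          fix t assume "t \<in> {T..}"
          then have t: "t \<ge> 1" using T by simp
          have "norm (g t) = t powr (\<alpha> - 1) * norm (W t)" by (simp add: gW norm_mult)
          also have "\<dots> \<le> t powr (\<alpha> - 1) * (B * t powr (- \<nu>) + (D + c * \<eta>) * t powr (- ?n))"
            using WB'[OF t] by (intro mult_left_mono) auto
          also have "\<dots> = B * t powr (\<alpha> - 1 - \<nu>) + (D + c * \<eta>) * t powr (\<alpha> - 1 - ?n)"
            using powr_add[of t "\<alpha> - 1" "- \<nu>"] powr_add[of t "\<alpha> - 1" "- ?n"] by (simp add: algebra_simps)
          finally show "norm (g t) \<le> B * t powr (\<alpha> - 1 - \<nu>) + (D + c * \<eta>) * t powr (\<alpha> - 1 - ?n)" .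
        qed (use gint hi T in \<open>auto simp: integrable_on_def\<close>)
        with integral_unique[OF hi] show ?thesis by simp
      qed
      have tail: "- (T powr (\<alpha> - 1 - y + 1)) / (\<alpha> - 1 - y + 1) = T powr (\<alpha> - y) / (y - \<alpha>)" for y
      proof -
        have "- (T powr (\<alpha> - y)) / (\<alpha> - y) = T powr (\<alpha> - y) / (- (\<alpha> - y))"
          by (simp only: divide_minus_right divide_minus_left)
        moreover have "\<alpha> - 1 - y + 1 = \<alpha> - y" by simp
        ultimately show ?thesis by (simp only: minus_diff_eq)
      qed
      have "norm (integral {0..} g) \<le> (M + c * \<eta>) * (T powr (\<alpha> - 1 + 1) / (\<alpha> - 1 + 1))
           + (B * (T powr (\<alpha> - \<nu>) / (\<nu> - \<alpha>)) + (D + c * \<eta>) * (T powr (\<alpha> - ?n) / (?n - \<alpha>)))"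
        unfolding split by (rule norm_triangle_mono[OF low high[unfolded tail]])
      then have "norm (integral {0..} g) \<le> (M + c * \<eta>) * T powr \<alpha> / \<alpha> + B * T powr (\<alpha> - \<nu>) / (\<nu> - \<alpha>)
           + (D + c * \<eta>) * T powr (\<alpha> - ?n) / (?n - \<alpha>)"
        by (simp only: diff_add_cancel times_divide_eq_right add.assoc)
      then have "c * \<kappa> * norm (\<Sum>i\<in>F. of_real (k i) * b i) \<le> (M + c * \<eta>) * T powr \<alpha> / \<alpha> + B * T powr (\<alpha> - \<nu>) / (\<nu> - \<alpha>)
           + (D + c * \<eta>) * T powr (\<alpha> - ?n) / (?n - \<alpha>)"
        using c \<kappa> by (simp add: gI norm_mult)
      moreover have "norm (riesz_potential \<alpha> b j) \<le> norm (\<Sum>i\<in>F. of_real (k i) * b i) + \<eta>"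
        using Fb[of k 1, OF k1] norm_triangle_sub[of "riesz_potential \<alpha> b j" "\<Sum>i\<in>F. of_real (k i) * b i"]
        by (simp add: kI)
      then have "c * \<kappa> * norm (riesz_potential \<alpha> b j) \<le> c * \<kappa> * (norm (\<Sum>i\<in>F. of_real (k i) * b i) + \<eta>)"
        using c \<kappa> by (intro mult_left_mono) auto
      ultimately show ?thesis by (simp add: distrib_left)
    qed
    note approx = this
    have "((\<lambda>\<eta>. c * \<kappa> * \<eta> + (M + c * \<eta>) * T powr \<alpha> / \<alpha> + B * T powr (\<alpha> - \<nu>) / (\<nu> - \<alpha>)
           + (D + c * \<eta>) * T powr (\<alpha> - ?n) / (?n - \<alpha>)) \<longlongrightarrow>
        c * \<kappa> * 0 + (M + c * 0) * T powr \<alpha> / \<alpha> + B * T powr (\<alpha> - \<nu>) / (\<nu> - \<alpha>)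
           + (D + c * 0) * T powr (\<alpha> - ?n) / (?n - \<alpha>)) (at_right 0)"
      using \<alpha> \<nu> by (intro tendsto_intros) auto
    then have "c * \<kappa> * norm (riesz_potential \<alpha> b j) \<le> c * \<kappa> * 0 + (M + c * 0) * T powr \<alpha> / \<alpha> + B * T powr (\<alpha> - \<nu>) / (\<nu> - \<alpha>)
           + (D + c * 0) * T powr (\<alpha> - ?n) / (?n - \<alpha>)"
      by (rule tendsto_lowerbound) (rule eventually_at_rightI[of 0 1], rule approx, auto)
    then show ?thesis by simp
  qed
  show ?thesis
    by (rule that[of "c * \<kappa>"]) (use c \<kappa> main in auto)
qed

subsection \<open>From pointwise to summed bounds\<close>

text \<open>From \<open>x + y \<le> 2 * max x y\<close>; one constant covers exponents on both sides
  of 1, as is wanted for \<open>p\<close> and \<open>q\<close>.\<close>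

lemma powr_add_le:
  fixes x y a :: real
  assumes "0 \<le> x" "0 \<le> y" "0 \<le> a"
  shows "(x + y) powr a \<le> 2 powr a * (x powr a + y powr a)"
proof -
  have "(x + y) powr a \<le> (2 * max x y) powr a" using assms by (intro powr_mono2) auto
  also have "\<dots> = 2 powr a * max x y powr a" using assms by (simp add: powr_mult)
  also have "\<dots> \<le> 2 powr a * (x powr a + y powr a)"
    by (intro mult_left_mono) (auto simp: max_def)
  finally show ?thesis .
qed

lemma ellp_sum_le:
  fixes b :: "int ^ 'n \<Rightarrow> 'a::real_normed_vector"
  assumes b: "b \<in> ellp p" and p: "p > 0" and N: "ellp_norm p b \<le> N" and A: "finite A"
  shows "(\<Sum>i\<in>A. norm (b i) powr p) \<le> N powr p"
proof -
  let ?S = "\<Sum>\<^sub>\<infinity>i. norm (b i) powr p"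
  have "(\<Sum>i\<in>A. norm (b i) powr p) \<le> ?S"
    using b A by (intro finite_sum_le_infsum) (auto simp: ellp_def)
  also have "?S = ellp_norm p b powr p"
    using p infsum_nonneg[of UNIV "\<lambda>i. norm (b i) powr p"] by (simp add: ellp_norm_def powr_powr)
  also have "\<dots> \<le> N powr p" using p N by (intro powr_mono2) (auto simp: ellp_norm_def)
  finally show ?thesis .
qed

lemma ellp_component_le:
  fixes b :: "int ^ 'n \<Rightarrow> 'a::real_normed_vector"
  assumes "b \<in> ellp p" "p > 0" "ellp_norm p b \<le> N" "N \<ge> 0"
  shows "norm (b i) \<le> N"
proof (rule ccontr)
  assume "\<not> norm (b i) \<le> N"
  then have "N powr p < norm (b i) powr p" using assms by (intro powr_less_mono2) auto
  with ellp_sum_le[OF assms(1-3), of "{i}"] show False by simp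
qed

text \<open>Every |b i| is at most \<open>N\<close>, so |b i| is at most
  \<open>N powr (1 - p)\<close> times its own \<open>p\<close>-th power.\<close>

lemma ellp_imp_abs_summable:
  fixes b :: "int ^ 'n \<Rightarrow> 'a::real_normed_vector"
  assumes b: "b \<in> ellp p" "p > 0" "ellp_norm p b \<le> N" "N \<ge> 0" and p1: "p \<le> 1"
  shows "(\<lambda>i. norm (b i)) summable_on UNIV" "(\<Sum>\<^sub>\<infinity>i. norm (b i)) \<le> N"
proof -
  have sum: "(\<Sum>i\<in>A. norm (b i)) \<le> N" if A: "finite A" for A
  proof -
    have "(\<Sum>i\<in>A. norm (b i)) \<le> (\<Sum>i\<in>A. N powr (1 - p) * norm (b i) powr p)"
    proof (rule sum_mono)
      fix i
      have "norm (b i) = norm (b i) powr (1 - p) * norm (b i) powr p" by (simp flip: powr_add)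
      also have "\<dots> \<le> N powr (1 - p) * norm (b i) powr p"
        using ellp_component_le[OF b] p1 by (intro mult_right_mono powr_mono2) auto
      finally show "norm (b i) \<le> N powr (1 - p) * norm (b i) powr p" .
    qed
    also have "\<dots> \<le> N powr (1 - p) * N powr p"
      unfolding sum_distrib_left[symmetric] using ellp_sum_le[OF b(1-3) A] by (intro mult_left_mono) auto
    also have "\<dots> = N" using \<open>N \<ge> 0\<close> by (simp flip: powr_add)
    finally show ?thesis .
  qed
  show s: "(\<lambda>i. norm (b i)) summable_on UNIV"
    by (rule nonneg_bdd_above_summable_on) (auto simp: bdd_above_def intro!: exI[of _ N] sum)
  show "(\<Sum>\<^sub>\<infinity>i. norm (b i)) \<le> N" by (rule infsum_le_finite_sums[OF s sum])
qed

text \<open>Bounds on finite sums yield membership together with the norm bound. Membership matters,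
  since \<open>ellp_norm\<close> is 0 by default when the series diverges.\<close>

lemma ellp_norm_leI:
  fixes f :: "int ^ 'n \<Rightarrow> 'a::real_normed_vector"
  assumes q: "q > 0" and "\<And>A. finite A \<Longrightarrow> (\<Sum>i\<in>A. norm (f i) powr q) \<le> K" and "K \<ge> 0"
  shows "f \<in> ellp q" "ellp_norm q f \<le> K powr (1 / q)"
proof -
  have s: "(\<lambda>i. norm (f i) powr q) summable_on UNIV"
    by (rule nonneg_bdd_above_summable_on) (auto simp: bdd_above_def intro!: exI[of _ K] assms)
  then show "f \<in> ellp q" by (simp add: ellp_def)
  have "(\<Sum>\<^sub>\<infinity>i. norm (f i) powr q) \<le> K" using infsum_le_finite_sums[OF s assms(2)] by simp
  then show "ellp_norm q f \<le> K powr (1 / q)"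
    unfolding ellp_norm_def using q by (intro powr_mono2 infsum_nonneg) auto
qed

section \<open>The pointwise bound of Hedberg type and its summation\<close>

text \<open>The split point \<open>T\<close> is chosen to make the maximal term and the decay term
  equal, whence the factor 2. The summand |b j| comes from the origin term of the full
  kernel.\<close>

lemma riesz_potential_pointwise_le:
  fixes c \<alpha> p :: real
  assumes c: "0 < c" and \<alpha>: "0 < \<alpha>" "\<alpha> < real CARD('n::finite)" and p: "0 < p" "p \<le> 1"
  obtains E where "E > 0" and
    "\<And>(b :: int ^ 'n \<Rightarrow> complex) j. b \<in> hardy_space c p \<Longrightarrow>
      norm (riesz_potential \<alpha> b j) \<le> E * (2 * poisson_maximal c b j powr (1 - \<alpha> * p / real CARD('n)) *
        hardy_norm c p b powr (\<alpha> * p / real CARD('n)) + norm (b j))"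
proof -
  let ?n = "real CARD('n)"
  define \<nu> where "\<nu> = ?n / p"
  have \<nu>: "\<nu> > \<alpha>" "\<nu> > 0"
  proof -
    have "?n \<le> ?n / p" using p by (simp add: le_divide_eq mult_left_le)
    then show "\<nu> > \<alpha>" "\<nu> > 0" using \<alpha> by (simp_all add: \<nu>_def)
  qed
  obtain C where C: "C > 0"
    and decay: "\<And>(b :: int ^ 'n \<Rightarrow> complex) G H x t.
      (\<lambda>i. norm (b i)) summable_on UNIV \<Longrightarrow> (\<Sum>\<^sub>\<infinity>i. norm (b i)) \<le> H \<Longrightarrow>
      (\<And>A. finite A \<Longrightarrow> (\<Sum>j\<in>A. G j powr p) \<le> H powr p) \<Longrightarrow>
      (\<And>j t. t \<ge> 1 \<Longrightarrow> norm (poisson_extension b (lattice_point j) t) \<le> G j) \<Longrightarrow> t \<ge> 1 \<Longrightarrow>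
      norm (poisson_extension b x t) \<le> C * t powr (- \<nu>) * H"
    using poisson_extension_decay[OF p(1), where 'n = 'n] unfolding \<nu>_def by metis
  obtain \<kappa> where \<kappa>: "\<kappa> > 0" and
    riesz: "\<And>(b :: int ^ 'n \<Rightarrow> complex) j M B D \<nu> T.
      (\<lambda>i. norm (b i)) summable_on UNIV \<Longrightarrow>
      (\<And>t. t > 0 \<Longrightarrow> norm (zconv (poisson_kernel c t) b j) \<le> M) \<Longrightarrow>
      (\<And>t. t \<ge> 1 \<Longrightarrow> norm (zconv (poisson_kernel c t) b j) \<le> B * t powr (- \<nu>) + D * t powr (- ?n)) \<Longrightarrow>
      \<nu> > \<alpha> \<Longrightarrow> T \<ge> 1 \<Longrightarrow>
      \<kappa> * norm (riesz_potential \<alpha> b j)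
        \<le> M * T powr \<alpha> / \<alpha> + B * T powr (\<alpha> - \<nu>) / (\<nu> - \<alpha>) + D * T powr (\<alpha> - ?n) / (?n - \<alpha>)"
    using norm_riesz_potential_le[OF c \<alpha>] by metis
  \<comment> \<open>Chosen so that \<open>H powr p = h * N powr p\<close> dominates the sums of
    \<open>G j powr p\<close>. The added 1 gives \<open>h \<ge> 1\<close>, hence
    \<open>H \<ge> N\<close>, which bounds the absolute sum of \<open>b\<close>.\<close>
  define h where "h = 2 powr p * (1 / c powr p + 1) + 1"
  have h: "h \<ge> 1" by (simp add: h_def)
  \<comment> \<open>One summand for each term in \<open>riesz\<close>: heights below
    \<open>T\<close>, the decay term and the origin term.\<close>
  define E where "E = (1 / \<alpha> + c * C * h powr (1 / p) / (\<nu> - \<alpha>) + c / (?n - \<alpha>)) / \<kappa>"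
  have terms: "1 / \<alpha> > 0" "c * C * h powr (1 / p) / (\<nu> - \<alpha>) > 0" "c / (?n - \<alpha>) > 0"
    using c C h \<alpha> \<nu> by auto
  then have E: "E > 0" unfolding E_def by (intro divide_pos_pos[OF add_pos_pos[OF add_pos_pos]] \<kappa>)
  have main: "norm (riesz_potential \<alpha> b j) \<le> E * (2 * poisson_maximal c b j powr (1 - \<alpha> / \<nu>) *
      hardy_norm c p b powr (\<alpha> / \<nu>) + norm (b j))"
    if b: "b \<in> hardy_space c p" for b :: "int ^ 'n \<Rightarrow> complex" and j
  proof -
    define N where "N = hardy_norm c p b"
    define M where "M = poisson_maximal c b"
    have bp: "b \<in> ellp p" and Mp: "M \<in> ellp p"
      and bdd: "\<And>j. bdd_above ((\<lambda>t. norm (zconv (poisson_kernel c t) b j)) ` {0<..})"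
      using b by (auto simp: hardy_space_def M_def)
    have bN: "ellp_norm p b \<le> N" and MN: "ellp_norm p M \<le> N" and N: "N \<ge> 0"
      by (auto simp: N_def hardy_norm_def ellp_norm_def M_def)
    have WM: "norm (zconv (poisson_kernel c t) b j) \<le> M j" if "t > 0" for t j
      unfolding M_def poisson_maximal_def using that by (intro cSUP_upper bdd) auto
    have M0: "M j \<ge> 0" for j using WM[of 1 j] norm_ge_zero order_trans by (metis zero_less_one)
    have MjN: "M j \<le> N" for j using ellp_component_le[OF Mp p(1) MN N, of j] M0[of j] by simp
    note abs = ellp_imp_abs_summable[OF bp p(1) bN N p(2)]
    define H where "H = h powr (1 / p) * N"
    have HN: "H \<ge> N" using h p N mult_right_mono[of 1 "h powr (1 / p)" N] by (simp add: H_def ge_one_powr_ge_zero)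
    have Hp: "H powr p = h * N powr p" using h p N by (simp add: H_def powr_mult powr_powr)
    \<comment> \<open>A bound for the full Poisson extension at lattice points: the maximal function
      over \<open>c\<close>, plus the origin term, which is at most |b j| for
      \<open>t \<ge> 1\<close>.\<close>
    define G where "G j = M j / c + norm (b j)" for j
    have GH: "(\<Sum>j\<in>A. G j powr p) \<le> H powr p" if A: "finite A" for A
    proof -
      have "(\<Sum>j\<in>A. G j powr p) \<le> (\<Sum>j\<in>A. 2 powr p * (1 / c powr p * norm (M j) powr p + norm (b j) powr p))"
        unfolding G_def
      proof (rule sum_mono)
        fix j
        have "(M j / c + norm (b j)) powr p \<le> 2 powr p * ((M j / c) powr p + norm (b j) powr p)"
          using M0[of j] c p by (intro powr_add_le) auto
        then show "(M j / c + norm (b j)) powr p \<le> 2 powr p * (1 / c powr p * norm (M j) powr p + norm (b j) powr p)"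
          using M0[of j] c by (simp add: powr_divide)
      qed
      also have "\<dots> = 2 powr p * (1 / c powr p * (\<Sum>j\<in>A. norm (M j) powr p) + (\<Sum>j\<in>A. norm (b j) powr p))"
        by (simp add: sum_distrib_left sum.distrib distrib_left)
      also have "\<dots> \<le> 2 powr p * (1 / c powr p * N powr p + N powr p)"
        by (intro mult_left_mono add_mono ellp_sum_le Mp bp p MN bN A) auto
      also have "\<dots> \<le> h * N powr p" by (simp add: h_def algebra_simps)
      finally show ?thesis by (simp add: Hp)
    qed
    have K0: "full_kernel (0 :: real ^ 'n) t = t powr (- ?n)" if "t > 0" for t
    proof -
      have "(t\<^sup>2) powr ((?n + 1) / 2) = t powr (?n + 1)"
        using that by (simp add: powr_powr add_divide_distrib flip: powr_numeral)
      then show ?thesis using that by (simp add: full_kernel_eq powr_add powr_minus field_simps)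
    qed
    have UG: "norm (poisson_extension b (lattice_point j) t) \<le> G j" if t: "t \<ge> 1" for j t
    proof -
      have "t powr (- ?n) \<le> t powr 0" using t by (intro powr_mono) auto
      then have "t powr (- ?n) * norm (b j) \<le> norm (b j)" using t by (intro mult_left_le_one_le) auto
      then have *: "c * t powr (- ?n) * norm (b j) \<le> c * norm (b j)"
        unfolding mult.assoc using c by (intro mult_left_mono) auto
      have "norm (of_real c * poisson_extension b (lattice_point j) t)
        \<le> norm (zconv (poisson_kernel c t) b j) + norm (of_real (c * full_kernel (0 :: real ^ 'n) t) * b j)"
        using t c by (subst poisson_extension_lattice_eq[OF abs(1)]) (auto intro: norm_triangle_ineq)
      also have "norm (of_real (c * full_kernel (0 :: real ^ 'n) t) * b j) = c * t powr (- ?n) * norm (b j)"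
        using t c by (simp add: norm_mult K0)
      finally have "c * norm (poisson_extension b (lattice_point j) t)
          \<le> norm (zconv (poisson_kernel c t) b j) + c * t powr (- ?n) * norm (b j)"
        using c by (simp add: norm_mult)
      also have "\<dots> \<le> M j + c * norm (b j)" using WM[of t j] * t by (intro add_mono) auto
      finally have "c * norm (poisson_extension b (lattice_point j) t) \<le> M j + c * norm (b j)" .
      then show ?thesis using c by (simp add: G_def field_simps)
    qed
    have WB: "norm (zconv (poisson_kernel c t) b j) \<le> (c * C * H) * t powr (- \<nu>) + (c * norm (b j)) * t powr (- ?n)"
      if t: "t \<ge> 1" for t
    proof -
      have "zconv (poisson_kernel c t) b j = of_real c * poisson_extension b (lattice_point j) t
        - of_real (c * full_kernel (0 :: real ^ 'n) t) * b j"
        using t c poisson_extension_lattice_eq[OF abs(1), of t c j] by simp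
      then have "norm (zconv (poisson_kernel c t) b j) \<le> norm (of_real c * poisson_extension b (lattice_point j) t)
        + norm (of_real (c * full_kernel (0 :: real ^ 'n) t) * b j)"
        by (simp only: norm_triangle_ineq4)
      also have "\<dots> = c * norm (poisson_extension b (lattice_point j) t) + (c * norm (b j)) * t powr (- ?n)"
        using t c by (simp add: norm_mult K0)
      also have "\<dots> \<le> c * (C * t powr (- \<nu>) * H) + (c * norm (b j)) * t powr (- ?n)"
        using c decay[OF abs(1) order_trans[OF abs(2) HN] GH UG t]
        by (intro add_mono mult_left_mono) auto
      finally show ?thesis by (simp add: mult_ac)
    qed
    have bound: "norm (riesz_potential \<alpha> b j) \<le> E * (M j * T powr \<alpha> + N * T powr (\<alpha> - \<nu>) + norm (b j))"
      if T: "T \<ge> 1" for T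
    proof -
      have Tn: "T powr (\<alpha> - ?n) \<le> 1" using powr_mono[of "\<alpha> - ?n" 0 T] T \<alpha> by simp
      let ?x = "M j * T powr \<alpha>" and ?y = "N * T powr (\<alpha> - \<nu>)" and ?z = "norm (b j)"
      let ?s = "?x + ?y + ?z"
      have xyz: "?x \<ge> 0" "?y \<ge> 0" "?z \<ge> 0" using M0[of j] N by auto
      have "\<kappa> * norm (riesz_potential \<alpha> b j) \<le> M j * T powr \<alpha> / \<alpha>
          + (c * C * H) * T powr (\<alpha> - \<nu>) / (\<nu> - \<alpha>) + (c * norm (b j)) * T powr (\<alpha> - ?n) / (?n - \<alpha>)"
        by (rule riesz[OF abs(1) WM WB \<nu>(1) T])
      also have "\<dots> = 1 / \<alpha> * ?x + c * C * h powr (1 / p) / (\<nu> - \<alpha>) * ?y + c / (?n - \<alpha>) * (?z * T powr (\<alpha> - ?n))"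
        by (simp add: H_def)
      also have "\<dots> \<le> 1 / \<alpha> * ?s + c * C * h powr (1 / p) / (\<nu> - \<alpha>) * ?s + c / (?n - \<alpha>) * ?s"
      proof (intro add_mono mult_left_mono)
        have "?z * T powr (\<alpha> - ?n) \<le> ?z * 1" using Tn by (intro mult_left_mono) auto
        then show "?z * T powr (\<alpha> - ?n) \<le> ?s" using xyz by linarith
      qed (use xyz terms in auto)
      also have "\<dots> = \<kappa> * (E * ?s)"
        using \<kappa> by (simp add: E_def distrib_right)
      finally show ?thesis using \<kappa> by (simp only: mult_le_cancel_left_pos)
    qed
    show ?thesis unfolding N_def[symmetric] M_def[symmetric]
    proof (cases "M j = 0")
      case True
      \<comment> \<open>No \<open>T\<close> balances the terms when \<open>M j\<close> vanishes;
        letting \<open>T\<close> tend to infinity removes the term with \<open>N\<close>.\<close>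
      have "((\<lambda>T. E * (M j * T powr \<alpha> + N * T powr (\<alpha> - \<nu>) + norm (b j))) \<longlongrightarrow> E * (0 + N * 0 + norm (b j))) at_top"
        unfolding True using \<nu> by (intro tendsto_intros tendsto_neg_powr filterlim_ident) auto
      then have "norm (riesz_potential \<alpha> b j) \<le> E * (0 + N * 0 + norm (b j))"
        by (rule tendsto_lowerbound) (use bound in \<open>auto simp: eventually_at_top_linorder\<close>)
      then show "norm (riesz_potential \<alpha> b j) \<le> E * (2 * M j powr (1 - \<alpha> / \<nu>) * N powr (\<alpha> / \<nu>) + norm (b j))"
        by (simp add: True)
    next
      case False
      then have Mpos: "M j > 0" using M0[of j] by simp
      then have Npos: "N > 0" using MjN[of j] by simp
      \<comment> \<open>The solution of
        \<open>M j * T powr \<alpha> = N * T powr (\<alpha> - \<nu>)\<close>. It is at least 1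
        because the single value \<open>M j\<close> is at most the \<open>p\<close>-norm of
        \<open>M\<close>, hence at most \<open>N\<close>.\<close>
      define T where "T = (N / M j) powr (1 / \<nu>)"
      have T: "T \<ge> 1" unfolding T_def using MjN[of j] Mpos \<nu> by (intro ge_one_powr_ge_zero) auto
      have "T powr \<alpha> = N powr (\<alpha> / \<nu>) / M j powr (\<alpha> / \<nu>)"
        using Mpos Npos by (simp add: T_def powr_powr powr_divide)
      then have 1: "M j * T powr \<alpha> = M j powr (1 - \<alpha> / \<nu>) * N powr (\<alpha> / \<nu>)"
        using Mpos by (simp add: powr_diff)
      have "T powr \<nu> = N / M j"
        using Mpos Npos \<nu> by (simp add: T_def powr_powr)
      then have 2: "N * T powr (\<alpha> - \<nu>) = M j * T powr \<alpha>"
        using Mpos Npos by (simp add: powr_diff)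
      show "norm (riesz_potential \<alpha> b j) \<le> E * (2 * M j powr (1 - \<alpha> / \<nu>) * N powr (\<alpha> / \<nu>) + norm (b j))"
        using bound[OF T] unfolding 2 unfolding 1 by (simp add: mult_ac)
    qed
  qed
  have "\<alpha> / \<nu> = \<alpha> * p / ?n" by (simp add: \<nu>_def)
  with that[OF E] main show ?thesis by simp
qed

theorem theorem3p3:
  fixes c \<alpha> p q :: real
  assumes "0 < c"
    and "0 < \<alpha>" and "\<alpha> < real CARD('n::finite)"
    and "0 < p" and "p \<le> 1"
    and "1 / q = 1 / p - \<alpha> / real CARD('n)"
  shows "\<exists>C>0. \<forall>b :: int ^ 'n \<Rightarrow> complex. b \<in> hardy_space c p \<longrightarrow>
           riesz_potential \<alpha> b \<in> ellp q \<and>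
           ellp_norm q (riesz_potential \<alpha> b) \<le> C * hardy_norm c p b"
proof -
  let ?n = "real CARD('n)"
  define \<theta> where "\<theta> = \<alpha> * p / ?n"
  have p: "0 < p" "p \<le> 1" by fact+
  have n: "?n > 0" using assms(2,3) by linarith
  have \<theta>: "0 < \<theta>" "\<theta> < 1"
  proof -
    have "\<alpha> * p \<le> \<alpha>" using assms by (simp add: mult_left_le)
    then have "\<alpha> * p < ?n" using assms(3) by linarith
    then show "\<theta> < 1" using n by (simp add: \<theta>_def)
    show "0 < \<theta>" using assms n by (simp add: \<theta>_def)
  qed
  have pq: "1 / q = (1 - \<theta>) / p" using assms(4,6) by (simp add: \<theta>_def diff_divide_distrib)
  \<comment> \<open>Positivity of \<open>1 / q\<close> also excludes \<open>q = 0\<close>, where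
    \<open>1 / q\<close> would be 0 by convention.\<close>
  have q: "q > 0" using pq \<theta> p by (metis diff_gt_0_iff_gt divide_pos_pos zero_less_divide_1_iff)
  \<comment> \<open>With this identity the \<open>q\<close>-th power of
    \<open>M j powr (1 - \<theta>)\<close> is \<open>M j powr p\<close>, which is summable.\<close>
  have q\<theta>: "q * (1 - \<theta>) = p" using pq p q by (simp add: field_simps)
  have "q * \<theta> > 0" using q \<theta> by simp
  then have pleq: "p \<le> q" using q\<theta> by (simp add: right_diff_distrib)
  have q\<theta>': "q * \<theta> = q - p" using q\<theta> by (simp add: right_diff_distrib)
  obtain E where E: "E > 0" and
    pointwise: "\<And>(b :: int ^ 'n \<Rightarrow> complex) j. b \<in> hardy_space c p \<Longrightarrow>
      norm (riesz_potential \<alpha> b j) \<le> E * (2 * poisson_maximal c b j powr (1 - \<theta>) *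
        hardy_norm c p b powr \<theta> + norm (b j))"
    using riesz_potential_pointwise_le[OF assms(1-5)] unfolding \<theta>_def by metis
  \<comment> \<open>The first \<open>2 powr q\<close> comes from \<open>powr_add_le\<close>, the
    second from the factor 2 in the pointwise bound; the 1 belongs to the term with
    \<open>b\<close>.\<close>
  define K where "K = E powr q * 2 powr q * (2 powr q + 1)"
  have K: "K > 0" using E by (simp add: K_def add_pos_pos)
  show ?thesis
  proof (intro exI[of _ "K powr (1 / q)"] conjI allI impI)
    show "K powr (1 / q) > 0" using K by simp
    fix b :: "int ^ 'n \<Rightarrow> complex" assume b: "b \<in> hardy_space c p"
    define N where "N = hardy_norm c p b"
    define M where "M = poisson_maximal c b"
    have bp: "b \<in> ellp p" and Mp: "M \<in> ellp p" using b by (auto simp: hardy_space_def M_def)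
    have bN: "ellp_norm p b \<le> N" and MN: "ellp_norm p M \<le> N" and N: "N \<ge> 0"
      by (auto simp: N_def hardy_norm_def ellp_norm_def M_def)
    have sum: "(\<Sum>j\<in>A. norm (riesz_potential \<alpha> b j) powr q) \<le> K * N powr q" if A: "finite A" for A
    proof -
      have M0: "M j \<ge> 0" for j
      proof -
        have "norm (zconv (poisson_kernel c 1) b j) \<le> M j"
          using b unfolding M_def poisson_maximal_def hardy_space_def by (intro cSUP_upper) auto
        then show ?thesis using norm_ge_zero order_trans by blast
      qed
      have "(\<Sum>j\<in>A. norm (riesz_potential \<alpha> b j) powr q)
        \<le> (\<Sum>j\<in>A. E powr q * 2 powr q * N powr (q - p) * (2 powr q * norm (M j) powr p + norm (b j) powr p))"
      proof (rule sum_mono)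
        fix j
        have "norm (riesz_potential \<alpha> b j) powr q \<le> (E * (2 * M j powr (1 - \<theta>) * N powr \<theta> + norm (b j))) powr q"
          unfolding M_def N_def using pointwise[OF b] q by (intro powr_mono2) auto
        also have "\<dots> = E powr q * (2 * M j powr (1 - \<theta>) * N powr \<theta> + norm (b j)) powr q"
          using E by (simp add: powr_mult)
        also have "\<dots> \<le> E powr q * (2 powr q * ((2 * M j powr (1 - \<theta>) * N powr \<theta>) powr q + norm (b j) powr q))"
          using q by (intro mult_left_mono powr_add_le) auto
        also have "(2 * M j powr (1 - \<theta>) * N powr \<theta>) powr q = N powr (q - p) * (2 powr q * norm (M j) powr p)"
          using M0[of j] by (simp add: powr_mult powr_powr mult.commute[of _ q] q\<theta> q\<theta>')
        also have "E powr q * (2 powr q * (N powr (q - p) * (2 powr q * norm (M j) powr p) + norm (b j) powr q))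
          \<le> E powr q * (2 powr q * (N powr (q - p) * (2 powr q * norm (M j) powr p) + N powr (q - p) * norm (b j) powr p))"
        proof (intro mult_left_mono add_left_mono)
          \<comment> \<open>The embedding of the \<open>p\<close>-space in the
            \<open>q\<close>-space: \<open>q - p\<close> of the factors are bounded by
            \<open>N\<close>.\<close>
          have "norm (b j) powr q = norm (b j) powr (q - p) * norm (b j) powr p" by (simp flip: powr_add)
          also have "\<dots> \<le> N powr (q - p) * norm (b j) powr p"
            using ellp_component_le[OF bp p(1) bN N] pleq by (intro mult_right_mono powr_mono2) auto
          finally show "norm (b j) powr q \<le> N powr (q - p) * norm (b j) powr p" .
        qed auto
        finally show "norm (riesz_potential \<alpha> b j) powr q
          \<le> E powr q * 2 powr q * N powr (q - p) * (2 powr q * norm (M j) powr p + norm (b j) powr p)"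
          by (simp add: algebra_simps)
      qed
      also have "\<dots> = E powr q * 2 powr q * N powr (q - p)
          * (2 powr q * (\<Sum>j\<in>A. norm (M j) powr p) + (\<Sum>j\<in>A. norm (b j) powr p))"
        by (simp only: sum_distrib_left sum.distrib distrib_left)
      also have "\<dots> \<le> E powr q * 2 powr q * N powr (q - p) * (2 powr q * N powr p + N powr p)"
        by (intro mult_left_mono add_mono ellp_sum_le[OF Mp p(1) MN A] ellp_sum_le[OF bp p(1) bN A]) auto
      also have "\<dots> = K * (N powr (q - p) * N powr p)" by (simp add: K_def algebra_simps)
      also have "N powr (q - p) * N powr p = N powr q" by (simp flip: powr_add)
      finally show ?thesis .
    qed
    from ellp_norm_leI[OF q sum] K N
    show "riesz_potential \<alpha> b \<in> ellp q" by simp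
    have "ellp_norm q (riesz_potential \<alpha> b) \<le> (K * N powr q) powr (1 / q)"
      using ellp_norm_leI(2)[OF q sum] K N by simp
    also have "\<dots> = K powr (1 / q) * N" using K N q by (simp add: powr_mult powr_powr)
    finally show "ellp_norm q (riesz_potential \<alpha> b) \<le> K powr (1 / q) * hardy_norm c p b"
      by (simp add: N_def)
  qed
qed

end
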